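(* For $C_0\ge0$ let $F_d(C_0):=\sup_{\rho\in\mathfrak M_d:\,\chi_*(\rho)\le C_0}\operatorname{tr}\Sigma(\rho)$. Then $$F_d(C_0)=\sup\{s:(c,s)\in\mathrm{conv}(\Gamma_d),\ c\le C_0\}.$$ Moreover, for every $C_0\ge0$ there exist $a,b\in\Omega_d$ and $t\in[0,1]$ with $$F_d(C_0)=tS(a)+(1-t)S(b),\qquad tC(a)+(1-t)C(b)=C_0,$$ so the law $t\rho_a+(1-t)\rho_b$ (a mixture of at most two exchangeable orbit laws) is feasible and optimal; furthermore, for $C_0>0$ every exchangeable optimizer, described by a probability law $\nu$ on $\Omega_d$ of its sorted templates, satisfies $\int C\,d\nu=C_0$ (it saturates the budget).
   Context: Fix $d\ge2$. Let $H\in\mathbb R^{d\times(d-1)}$ have orthonormal columns spanning $\{u\in\mathbb R^d:\mathbf 1^\top u=0\}$, $\gamma_i:=H^\top e_i$, $\mathcal X_d:=\{x\in\mathbb R^{d-1}:1+\gamma_i^\top x\ge0\ \forall i\}$, $\mathcal K_d:=\{a\in\mathbb R^d_+:\sum a_i=d\}$; the map $a\mapsto x(a):=H^\top(a-\mathbf 1)$ is an affine bijection $\mathcal K_d\to\mathcal X_d$ with inverse $x\mapsto\mathbf 1+Hx$ (the template of $x$). An anchored law is a Borel probability measure $\rho$ on $\mathcal X_d$ with $\int x\,\rho(dx)=0$; $\mathfrak M_d$ is the set of anchored laws; $\Sigma(\rho):=\int xx^\top\rho(dx)$; $\chi_*(\rho):=\max_{i\ne j}\int\frac{((\gamma_j-\gamma_i)^\top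 x)^2}{1+\gamma_i^\top x}\rho(dx)$ (integrand $0$ where $1+\gamma_i^\top x=0=(\gamma_j-\gamma_i)^\top x$, $+\infty$ where $1+\gamma_i^\top x=0\ne(\gamma_j-\gamma_i)^\top x$). For a permutation $\pi$ with matrix $\Pi$ let $P_\pi:=H^\top\Pi H$; $\rho$ is exchangeable if $(P_\pi)_\#\rho=\rho$ for all $\pi$. Let $\Omega_d:=\{a\in\mathcal K_d:a_1\ge\dots\ge a_d,\ a_d>0\}$; for $a\in\Omega_d$, $\rho_a:=\frac1{d!}\sum_\pi\delta_{P_\pi x(a)}$ (uniform on the permutation orbit of $x(a)$). With $A(a):=\sum_i1/a_i$, $B(a):=\sum_ia_i^2$, set $S(a):=B(a)-d$, $C(a):=\frac{A(a)B(a)-d^2}{d(d-1)}$, and $\Gamma_d:=\{(C(a),S(a)):a\in\Omega_d\}\subset\mathbb R^2$. *)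

theory Defs
  imports "HOL-Probability.Probability"
begin

text \<open>Dimension conventions: the index type 'n (finite, linearly ordered) has CARD('n) = d
  and indexes coordinates of R^d; the finite type 'm has CARD('m) = d-1 and indexes coordinates
  of R^(d-1).  A matrix H in R^(d x (d-1)) is  H :: real^'m^'n  (row i is  H $ i = gamma_i).\<close>

definition Xd :: "real^'m^'n \<Rightarrow> (real^'m) set" where
  "Xd H = {x. \<forall>i. 0 \<le> 1 + (H $ i) \<bullet> x}"

definition anchored :: "real^'m^'n \<Rightarrow> (real^'m) measure \<Rightarrow> bool" where
  "anchored H \<rho> \<longleftrightarrow> prob_space \<rho> \<and> sets \<rho> = sets borel \<and> emeasure \<rho> (Xd H) = 1
     \<and> integrable \<rho> (\<lambda>x. x) \<and> (\<integral>x. x \<partial>\<rho>) = 0"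

definition Sigma_mat :: "(real^'m) measure \<Rightarrow> real^'m^'m" where
  "Sigma_mat \<rho> = (\<chi> i j. \<integral>x. (x $ i) * (x $ j) \<partial>\<rho>)"

definition chi_integrand :: "real^'m^'n \<Rightarrow> 'n \<Rightarrow> 'n \<Rightarrow> real^'m \<Rightarrow> ennreal" where
  "chi_integrand H i j x =
     (let den = 1 + (H $ i) \<bullet> x; num = (H $ j - H $ i) \<bullet> x in
      if den = 0 then (if num = 0 then 0 else \<infinity>) else ennreal (num\<^sup>2 / den))"

definition chi_star :: "real^'m^'n \<Rightarrow> (real^'m) measure \<Rightarrow> ennreal" where
  "chi_star H \<rho> = Max {(\<integral>\<^sup>+ x. chi_integrand H i j x \<partial>\<rho>) | i j. i \<noteq> j}"

definition perm_mat :: "('n \<Rightarrow> 'n) \<Rightarrow> real^'n^'n" where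
  "perm_mat p = (\<chi> i j. if i = p j then 1 else 0)"

definition Pmat :: "real^'m^'n \<Rightarrow> ('n \<Rightarrow> 'n) \<Rightarrow> real^'m^'m" where
  "Pmat H p = transpose H ** perm_mat p ** H"

definition exchangeable :: "real^'m^'n \<Rightarrow> (real^'m) measure \<Rightarrow> bool" where
  "exchangeable H \<rho> \<longleftrightarrow>
     (\<forall>p. p permutes (UNIV::'n set) \<longrightarrow> distr \<rho> borel (\<lambda>x. Pmat H p *v x) = \<rho>)"

definition Kd :: "(real^'n) set" where
  "Kd = {a. (\<forall>i. 0 \<le> a $ i) \<and> (\<Sum>i\<in>UNIV. a $ i) = real CARD('n)}"

definition Omega_d :: "(real^'n::{finite,linorder}) set" where
  "Omega_d = {a. a \<in> Kd \<and> (\<forall>i j. i \<le> j \<longrightarrow> a $ j \<le> a $ i) \<and> 0 < a $ (Max UNIV)}"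

definition xa :: "real^'m^'n \<Rightarrow> real^'n \<Rightarrow> real^'m" where
  "xa H a = transpose H *v (a - vec 1)"

definition template :: "real^'m^'n \<Rightarrow> real^'m \<Rightarrow> real^'n" where
  "template H x = vec 1 + H *v x"

definition Afun :: "real^'n \<Rightarrow> real" where "Afun a = (\<Sum>i\<in>UNIV. 1 / a $ i)"
definition Bfun :: "real^'n \<Rightarrow> real" where "Bfun a = (\<Sum>i\<in>UNIV. (a $ i)\<^sup>2)"
definition Sfun :: "real^'n \<Rightarrow> real" where "Sfun a = Bfun a - real CARD('n)"
definition Cfun :: "real^'n \<Rightarrow> real" where
  "Cfun a = (Afun a * Bfun a - (real CARD('n))\<^sup>2) / (real CARD('n) * (real CARD('n) - 1))"

definition Gamma_d :: "'n::{finite,linorder} itself \<Rightarrow> (real \<times> real) set" where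
  "Gamma_d _ = (\<lambda>a::real^'n::{finite,linorder}. (Cfun a, Sfun a)) ` Omega_d"

definition orbit_pmf :: "real^'m^'n \<Rightarrow> real^'n \<Rightarrow> (real^'m) pmf" where
  "orbit_pmf H a = map_pmf (\<lambda>p. Pmat H p *v xa H a) (pmf_of_set {p. p permutes (UNIV::'n set)})"

definition mixture_pmf :: "real \<Rightarrow> 'a pmf \<Rightarrow> 'a pmf \<Rightarrow> 'a pmf" where
  "mixture_pmf t p q = bind_pmf (bernoulli_pmf t) (\<lambda>c. if c then p else q)"

definition borel_law :: "(real^'m) pmf \<Rightarrow> (real^'m) measure" where
  "borel_law q = distr (measure_pmf q) borel (\<lambda>x. x)"

definition orbit_mixture :: "real^'m^'n \<Rightarrow> real \<Rightarrow> real^'n \<Rightarrow> real^'n \<Rightarrow> (real^'m) measure" where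
  "orbit_mixture H t a b = borel_law (mixture_pmf t (orbit_pmf H a) (orbit_pmf H b))"

definition sort_desc :: "real^'n::{finite,linorder} \<Rightarrow> real^'n::{finite,linorder}" where
  "sort_desc a = (THE b. (\<exists>p. p permutes (UNIV::'n::{finite,linorder} set) \<and> b = (\<chi> i. a $ p i))
                        \<and> (\<forall>i j. i \<le> j \<longrightarrow> b $ j \<le> b $ i))"

definition sorted_template_law :: "real^'m^'n::{finite,linorder} \<Rightarrow> (real^'m) measure \<Rightarrow> (real^'n::{finite,linorder}) measure" where
  "sorted_template_law H \<rho> = distr \<rho> borel (\<lambda>x. sort_desc (template H x))"

definition Fd :: "real^'m^'n \<Rightarrow> real \<Rightarrow> real" where
  "Fd H C0 = Sup {trace (Sigma_mat \<rho>) | \<rho>. anchored H \<rho> \<and> chi_star H \<rho> \<le> ennreal C0}"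

end

theory Submission
  imports Defs
begin

text \<open>Averaging the \<open>d (d - 1)\<close> integrands of \<open>\<chi>\<^sub>*\<close> over the pairs \<open>i \<noteq> j\<close> gives \<open>C\<close> of the template, and
  the trace of \<open>\<Sigma>\<close> is the mean of \<open>S\<close>; for exchangeable laws the pair integrals all agree, so the
  averaging loses nothing. Everything therefore reduces to one fact about the planar set \<open>\<Gamma>\<^sub>d\<close>: there is a
  line \<open>s = f + \<lambda> (c - C\<^sub>0)\<close> of slope \<open>\<lambda> > 0\<close> that lies above \<open>\<Gamma>\<^sub>d\<close> and touches it at points on
  both sides of \<open>c = C\<^sub>0\<close>. Integrating the inequality bounds \<open>F\<^sub>d(C\<^sub>0)\<close> by \<open>f\<close>, mixing the two contact
  points attains \<open>f\<close>, and \<open>\<lambda> > 0\<close> forces every optimizer to saturate the budget. The line comes from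
  separating hyperplanes after a projective compactification of \<open>\<Gamma>\<^sub>d\<close>; its slope cannot vanish
  because the bound \<open>S < d (d - 1)\<close> is approached but never attained.\<close>

section \<open>The functionals on the simplex\<close>

text \<open>Unlike \<open>Omega_d\<close>, this set is stable under permuting coordinates; on it the
  divisions in \<open>Afun\<close> and \<open>Cfun\<close> are genuine.\<close>

definition pos_simplex :: "(real^'n) set" where
  "pos_simplex = {a \<in> Kd. \<forall>i. 0 < a $ i}"

lemma Kd_sum: "a \<in> Kd \<Longrightarrow> (\<Sum>i\<in>UNIV. a $ i) = real CARD('n)" for a :: "real^'n"
  by (simp add: Kd_def)

lemma Kd_nonneg: "a \<in> Kd \<Longrightarrow> 0 \<le> a $ i"
  by (simp add: Kd_def)

lemma pos_simplex_Kd: "a \<in> pos_simplex \<Longrightarrow> a \<in> Kd"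
  by (simp add: pos_simplex_def)

lemma pos_simplex_pos: "a \<in> pos_simplex \<Longrightarrow> 0 < a $ i"
  by (simp add: pos_simplex_def)

lemma Kd_le_card:
  fixes a :: "real^'n"
  assumes "a \<in> Kd"
  shows "a $ i \<le> real CARD('n)"
  using member_le_sum[of i UNIV "\<lambda>i. a $ i"] Kd_sum[OF assms] Kd_nonneg[OF assms] by simp

lemma Sfun_eq_sum_squares:
  fixes a :: "real^'n"
  assumes "a \<in> Kd"
  shows "Sfun a = (\<Sum>i\<in>UNIV. (a $ i - 1)\<^sup>2)"
  using Kd_sum[OF assms]
  by (simp add: Sfun_def Bfun_def power2_diff sum.distrib sum_subtractf flip: sum_distrib_left)

lemma Sfun_nonneg: "a \<in> Kd \<Longrightarrow> 0 \<le> Sfun a"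
  by (simp add: Sfun_eq_sum_squares sum_nonneg)

lemma Sfun_le:
  fixes a :: "real^'n"
  assumes "a \<in> Kd"
  shows "Sfun a \<le> real CARD('n) * (real CARD('n) - 1)"
proof -
  have "Bfun a \<le> (\<Sum>i\<in>UNIV. real CARD('n) * a $ i)"
    unfolding Bfun_def power2_eq_square
    by (intro sum_mono mult_right_mono Kd_le_card Kd_nonneg assms)
  also have "\<dots> = real CARD('n) * real CARD('n)"
    using Kd_sum[OF assms] by (simp flip: sum_distrib_left)
  finally show ?thesis by (simp add: Sfun_def algebra_simps)
qed

lemma pos_simplex_less_card:
  fixes a :: "real^'n"
  assumes "a \<in> pos_simplex" "2 \<le> CARD('n)"
  shows "a $ i < real CARD('n)"
proof -
  have "UNIV - {i} \<noteq> {}"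
  proof
    assume "UNIV - {i} = {}"
    then have "(UNIV :: 'n set) = {i}" by blast
    then have "CARD('n) = 1" by (metis is_singletonI is_singleton_altdef)
    then show False using assms(2) by simp
  qed
  then have "0 < (\<Sum>j\<in>UNIV - {i}. a $ j)"
    by (intro sum_pos pos_simplex_pos[OF assms(1)]) auto
  moreover have "(\<Sum>j\<in>UNIV. a $ j) = a $ i + (\<Sum>j\<in>UNIV - {i}. a $ j)"
    by (simp add: sum.remove)
  ultimately show ?thesis using Kd_sum[OF pos_simplex_Kd[OF assms(1)]] by simp
qed

text \<open>Each coordinate lies strictly below d, so its square lies strictly below d times it. The
  strictness later rules out a horizontal supporting line.\<close>

lemma Sfun_less:
  fixes a :: "real^'n"
  assumes "a \<in> pos_simplex" "2 \<le> CARD('n)"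
  shows "Sfun a < real CARD('n) * (real CARD('n) - 1)"
proof -
  have "Bfun a < (\<Sum>i\<in>UNIV. real CARD('n) * a $ i)"
    unfolding Bfun_def power2_eq_square
    by (intro sum_strict_mono mult_strict_right_mono pos_simplex_less_card pos_simplex_pos assms) auto
  also have "\<dots> = real CARD('n) * real CARD('n)"
    using Kd_sum[OF pos_simplex_Kd[OF assms(1)]] by (simp flip: sum_distrib_left)
  finally show ?thesis by (simp add: Sfun_def algebra_simps)
qed

text \<open>Each term expands to \<open>a_j^2 / a_i - 2 a_j + a_i\<close>, and the coordinates sum
  to d. The right side is the sum of the integrands of \<open>chi_star\<close>; its diagonal terms
  vanish.\<close>

lemma Cfun_eq_pair_sum:
  fixes a :: "real^'n"
  assumes "a \<in> pos_simplex" "2 \<le> CARD('n)"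
  shows "real CARD('n) * (real CARD('n) - 1) * Cfun a = (\<Sum>i\<in>UNIV. \<Sum>j\<in>UNIV. (a $ j - a $ i)\<^sup>2 / a $ i)"
proof -
  have s: "(\<Sum>i\<in>UNIV. a $ i) = real CARD('n)" using Kd_sum[OF pos_simplex_Kd[OF assms(1)]] .
  have "(\<Sum>i\<in>UNIV. \<Sum>j\<in>UNIV. (a $ j - a $ i)\<^sup>2 / a $ i)
      = (\<Sum>i\<in>UNIV. \<Sum>j\<in>UNIV. 1 / a $ i * (a $ j)\<^sup>2 - 2 * a $ j + a $ i)"
    using pos_simplex_pos[OF assms(1)]
    by (intro sum.cong refl) (simp add: power2_eq_square field_simps less_imp_neq[symmetric])
  also have "\<dots> = (\<Sum>i\<in>UNIV. 1 / a $ i * Bfun a - 2 * real CARD('n) + real CARD('n) * a $ i)"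
    by (simp add: sum.distrib sum_subtractf Bfun_def s flip: sum_distrib_left sum_divide_distrib)
  also have "\<dots> = Afun a * Bfun a - (real CARD('n))\<^sup>2"
    by (simp add: sum.distrib sum_subtractf s Afun_def sum_distrib_right power2_eq_square flip: sum_distrib_left)
  finally show ?thesis using assms(2) by (simp add: Cfun_def)
qed

lemma Cfun_nonneg:
  fixes a :: "real^'n"
  assumes "a \<in> pos_simplex" "2 \<le> CARD('n)"
  shows "0 \<le> Cfun a"
proof -
  have "0 \<le> real CARD('n) * (real CARD('n) - 1) * Cfun a"
    unfolding Cfun_eq_pair_sum[OF assms]
    by (intro sum_nonneg divide_nonneg_nonneg) (auto intro: less_imp_le pos_simplex_pos[OF assms(1)])
  moreover have "0 < real CARD('n) * (real CARD('n) - 1)" using assms(2) by simp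
  ultimately show ?thesis by (simp only: zero_le_mult_iff) linarith
qed

text \<open>Replacing every denominator \<open>a $ i\<close> by the larger d turns the pair sum into
  \<open>2 * Sfun a\<close>. This supplies the supporting line for budget 0.\<close>

lemma Sfun_le_Cfun:
  fixes a :: "real^'n"
  assumes "a \<in> pos_simplex" "2 \<le> CARD('n)"
  shows "Sfun a \<le> real CARD('n) * (real CARD('n) - 1) / 2 * Cfun a"
proof -
  let ?d = "real CARD('n)"
  have s: "(\<Sum>i\<in>UNIV. a $ i) = ?d" using Kd_sum[OF pos_simplex_Kd[OF assms(1)]] .
  have "(\<Sum>i\<in>UNIV. \<Sum>j\<in>UNIV. (a $ j - a $ i)\<^sup>2 / ?d)
      = (\<Sum>i\<in>UNIV. \<Sum>j\<in>UNIV. (a $ j)\<^sup>2 - 2 * (a $ i * a $ j) + (a $ i)\<^sup>2) / ?d"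
    by (simp add: sum_divide_distrib power2_diff algebra_simps)
  also have "(\<Sum>i\<in>UNIV. \<Sum>j\<in>UNIV. (a $ j)\<^sup>2 - 2 * (a $ i * a $ j) + (a $ i)\<^sup>2)
      = (\<Sum>i\<in>UNIV. Bfun a - 2 * ?d * a $ i + ?d * (a $ i)\<^sup>2)"
    by (simp add: sum.distrib sum_subtractf Bfun_def s mult.assoc mult.commute[of "a $ _" ?d] flip: sum_distrib_left)
  also have "\<dots> = ?d * Bfun a - 2 * ?d * ?d + ?d * Bfun a"
    by (simp add: sum.distrib sum_subtractf s Bfun_def flip: sum_distrib_left)
  also have "\<dots> / ?d = 2 * Sfun a"
    by (simp add: Sfun_def field_simps)
  finally have "2 * Sfun a = (\<Sum>i\<in>UNIV. \<Sum>j\<in>UNIV. (a $ j - a $ i)\<^sup>2 / ?d)" ..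
  also have "\<dots> \<le> (\<Sum>i\<in>UNIV. \<Sum>j\<in>UNIV. (a $ j - a $ i)\<^sup>2 / a $ i)"
    using Kd_le_card[OF pos_simplex_Kd[OF assms(1)]] pos_simplex_pos[OF assms(1)]
    by (intro sum_mono divide_left_mono) auto
  also have "\<dots> = ?d * (?d - 1) * Cfun a"
    using Cfun_eq_pair_sum[OF assms] ..
  finally show ?thesis by simp
qed

text \<open>Since \<open>Afun a\<close> is at least \<open>1 / a $ k\<close> and
  \<open>Bfun a\<close> at least d, \<open>Cfun\<close> blows up at least like the reciprocal of any
  vanishing coordinate. This gives continuity of the compactification at the boundary.\<close>

lemma inverse_one_plus_Cfun_le:
  fixes a :: "real^'n"
  assumes "a \<in> pos_simplex" "2 \<le> CARD('n)"
  shows "1 / (1 + Cfun a) \<le> real CARD('n) * a $ k"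
proof -
  let ?d = "real CARD('n)"
  have d: "?d \<ge> 2" using assms(2) by simp
  have pos: "0 < a $ k" using pos_simplex_pos[OF assms(1)] .
  have C0: "0 \<le> Cfun a" using Cfun_nonneg[OF assms] .
  have "1 / a $ k \<le> Afun a"
    unfolding Afun_def
    by (rule member_le_sum) (auto intro: less_imp_le pos_simplex_pos[OF assms(1)])
  moreover have "?d \<le> Bfun a"
    using Sfun_nonneg[OF pos_simplex_Kd[OF assms(1)]] by (simp add: Sfun_def)
  ultimately have "1 / a $ k * ?d \<le> Afun a * Bfun a"
    using pos by (intro mult_mono) (auto intro: order_trans[rotated])
  also have "\<dots> = ?d * ((?d - 1) * Cfun a + ?d)"
    using d by (simp add: Cfun_def power2_eq_square field_simps)
  finally have "1 / a $ k \<le> (?d - 1) * Cfun a + ?d"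
    using d by (subst mult_le_cancel_left_pos[of ?d, symmetric]) (auto simp: mult.commute)
  also have "\<dots> \<le> ?d * (1 + Cfun a)"
    using C0 by (simp add: algebra_simps)
  finally show ?thesis using pos C0 by (simp add: field_simps)
qed

lemma one_in_pos_simplex: "(1 :: real^'n) \<in> pos_simplex"
  by (simp add: pos_simplex_def Kd_def)

lemma Sfun_one: "Sfun (1 :: real^'n) = 0"
  by (simp add: Sfun_def Bfun_def)

lemma Cfun_one: "Cfun (1 :: real^'n) = 0"
  by (simp add: Cfun_def Afun_def Bfun_def power2_eq_square)

text \<open>Giving a small value \<open>e\<close> to all coordinates but one approaches a vertex of
  the simplex, where \<open>Sfun\<close> equals d(d - 1).\<close>

lemma Sfun_approaches_bound:
  assumes "s < real CARD('n) * (real CARD('n) - 1)" "2 \<le> CARD('n)"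
  shows "\<exists>a \<in> (pos_simplex :: (real^'n) set). s < Sfun a"
proof -
  let ?d = "real CARD('n)"
  have d: "?d \<ge> 2" using assms(2) by simp
  define g where "g = ?d * (?d - 1) - s"
  have g: "0 < g" using assms by (simp add: g_def)
  \<comment> \<open>The bound 1/2 keeps the large coordinate positive; the other bound makes the
    loss \<open>2 * d * (d - 1) * e\<close> at most half of the gap \<open>g\<close>.\<close>
  define e where "e = min (1/2) (g / (4 * ?d * (?d - 1)))"
  have e: "0 < e" "e \<le> 1/2" "2 * ?d * (?d - 1) * e < g"
  proof -
    show "0 < e" "e \<le> 1/2" using g d by (auto simp: e_def)
    have "2 * ?d * (?d - 1) * e \<le> 2 * ?d * (?d - 1) * (g / (4 * ?d * (?d - 1)))"
      using d by (intro mult_left_mono) (auto simp: e_def)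
    also have "\<dots> = g / 2"
    proof -
      have "x * (g / (2 * x)) = g / 2" if "x > 0" for x :: real using that by simp
      from this[of "2 * ?d * (?d - 1)"] show ?thesis using d by (simp add: mult.assoc)
    qed
    finally show "2 * ?d * (?d - 1) * e < g" using g by simp
  qed
  fix k :: 'n
  define a :: "real^'n" where "a = (\<chi> i. if i = k then ?d - (?d - 1) * e else e)"
  have "(\<Sum>i\<in>UNIV. a $ i) = a $ k + (\<Sum>i\<in>UNIV - {k}. a $ i)"
    by (simp add: sum.remove)
  also have "(\<Sum>i\<in>UNIV - {k}. a $ i) = (?d - 1) * e"
    using assms(2) by (simp add: a_def of_nat_diff)
  finally have "(\<Sum>i\<in>UNIV. a $ i) = ?d" by (simp add: a_def)
  moreover have "0 < ?d - (?d - 1) * e"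
  proof -
    have "(?d - 1) * e \<le> (?d - 1) * 1" using d e by (intro mult_left_mono) auto
    then show ?thesis by simp
  qed
  ultimately have a: "a \<in> pos_simplex"
    using e by (auto simp: pos_simplex_def Kd_def a_def intro: less_imp_le)
  have "?d\<^sup>2 - 2 * ?d * (?d - 1) * e \<le> (?d - (?d - 1) * e)\<^sup>2"
    using zero_le_power2[of "(?d - 1) * e"] by (simp add: power2_eq_square algebra_simps)
  also have "\<dots> = (a $ k)\<^sup>2" by (simp add: a_def)
  also have "\<dots> \<le> Bfun a" unfolding Bfun_def by (rule member_le_sum) auto
  finally have "s < Sfun a"
    using e(3) by (simp add: Sfun_def g_def power2_eq_square algebra_simps)
  then show ?thesis using a by blast
qed

section \<open>Permuting and sorting coordinates\<close>

definition perm_vec :: "('n \<Rightarrow> 'n) \<Rightarrow> real^'n \<Rightarrow> real^'n" where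
  "perm_vec p a = (\<chi> i. a $ p i)"

lemma sum_perm_vec:
  "p permutes UNIV \<Longrightarrow> (\<Sum>i\<in>UNIV. f (perm_vec p a $ i)) = (\<Sum>i\<in>UNIV. f (a $ i))"
  unfolding perm_vec_def by (simp add: sum.permute[of p UNIV "\<lambda>i. f (a $ i)"] o_def)

lemma Sfun_perm_vec: "p permutes UNIV \<Longrightarrow> Sfun (perm_vec p a) = Sfun a"
  using sum_perm_vec[of p "\<lambda>x. x\<^sup>2" a] by (simp add: Sfun_def Bfun_def)

lemma Cfun_perm_vec: "p permutes UNIV \<Longrightarrow> Cfun (perm_vec p a) = Cfun a"
  using sum_perm_vec[of p "\<lambda>x. x\<^sup>2" a] sum_perm_vec[of p "\<lambda>x. 1 / x" a]
  by (simp add: Cfun_def Afun_def Bfun_def)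

lemma perm_vec_pos_simplex: "p permutes UNIV \<Longrightarrow> a \<in> pos_simplex \<Longrightarrow> perm_vec p a \<in> pos_simplex"
  using sum_perm_vec[of p "\<lambda>x. x" a] by (auto simp: pos_simplex_def Kd_def perm_vec_def)

definition descending :: "(real^'n::{finite,linorder}) set" where
  "descending = {a. \<forall>i j. i \<le> j \<longrightarrow> a $ j \<le> a $ i}"

text \<open>A permutation maximising the pairing with a strictly decreasing weight sorts the vector,
  since transposing an inversion would increase the pairing.\<close>

lemma ex_sorting_perm:
  fixes a :: "real^'n::{finite,linorder}"
  shows "\<exists>p. p permutes UNIV \<and> perm_vec p a \<in> descending"
proof -
  define r :: "'n \<Rightarrow> real" where "r i = - real (card {j. j < i})" for i
  have r: "r j < r i" if "i < j" for i j
  proof -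
    have "{k. k < i} \<subset> {k. k < j}" using that by auto
    then have "card {k. k < i} < card {k. k < j}" by (intro psubset_card_mono) auto
    then show ?thesis by (simp add: r_def)
  qed
  define F where "F p = (\<Sum>i\<in>UNIV. r i * a $ p i)" for p
  let ?P = "{p. p permutes (UNIV :: 'n set)}"
  have P: "finite ?P" by (simp add: finite_permutations)
  have P': "?P \<noteq> {}" using permutes_id[of "UNIV :: 'n set"] by blast
  obtain p where p: "p \<in> ?P" "Max (F ` ?P) = F p"
    using Max_in[of "F ` ?P"] P P' by blast
  have "a $ p j \<le> a $ p i" if "i \<le> j" for i j
  proof (rule ccontr)
    assume inv: "\<not> a $ p j \<le> a $ p i"
    then have ij: "i < j" using that by (metis order_le_less order_refl)
    define q where "q = p \<circ> Transposition.transpose i j"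
    have "q \<in> ?P" using p(1) by (auto simp: q_def intro: permutes_compose permutes_swap_id)
    have split: "F s = r i * a $ s i + r j * a $ s j + (\<Sum>k\<in>UNIV - {i} - {j}. r k * a $ s k)" for s
      using ij by (simp add: F_def sum.remove[of UNIV i] sum.remove[of "UNIV - {i}" j])
    have "(\<Sum>k\<in>UNIV - {i} - {j}. r k * a $ q k) = (\<Sum>k\<in>UNIV - {i} - {j}. r k * a $ p k)"
      by (rule sum.cong) (auto simp: q_def Transposition.transpose_def)
    then have "F q - F p = (r i - r j) * (a $ p j - a $ p i)"
      unfolding split by (simp add: q_def algebra_simps)
    also have "\<dots> > 0" using r[OF ij] inv by simp
    finally show False using Max_ge[of "F ` ?P" "F q"] \<open>q \<in> ?P\<close> P p(2) by simp
  qed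
  then show ?thesis using p(1) by (intro exI[of _ p]) (auto simp: descending_def perm_vec_def)
qed

text \<open>Counting: if the rearrangement \<open>c\<close> had \<open>c $ i > b $ i\<close>, the
  entries of \<open>b\<close> that are at least \<open>c $ i\<close> would all sit before index i,
  while those of \<open>c\<close> would fill all indices up to i. But \<open>r\<close> matches these
  two index sets bijectively.\<close>

lemma descending_perm_le:
  fixes b :: "real^'n::{finite,linorder}"
  assumes "b \<in> descending" "perm_vec r b \<in> descending" "r permutes UNIV"
  shows "perm_vec r b $ i \<le> b $ i"
proof (rule ccontr)
  define c where "c = perm_vec r b"
  assume "\<not> perm_vec r b $ i \<le> b $ i"
  then have lt: "b $ i < c $ i" by (simp add: c_def)
  have "{j. c $ i \<le> b $ j} \<subseteq> {j. j < i}"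
  proof
    fix j assume "j \<in> {j. c $ i \<le> b $ j}"
    then have "b $ i < b $ j" using lt by simp
    then have "\<not> i \<le> j" using assms(1) unfolding descending_def mem_Collect_eq by (meson not_le)
    then show "j \<in> {j. j < i}" by simp
  qed
  then have "card {j. c $ i \<le> b $ j} \<le> card {j. j < i}" by (intro card_mono) auto
  also have "\<dots> < card {j. j \<le> i}" by (intro psubset_card_mono) auto
  also have "\<dots> \<le> card {j. c $ i \<le> c $ j}"
    using assms(2) by (intro card_mono) (auto simp: descending_def c_def)
  also have "{j. c $ i \<le> b $ j} = r ` {j. c $ i \<le> c $ j}"
  proof -
    have "j \<in> r ` {j. c $ i \<le> c $ j}" if "c $ i \<le> b $ j" for j
      using that permutes_inverses(1)[OF assms(3)]
      by (intro image_eqI[of _ _ "inv r j"]) (auto simp: c_def perm_vec_def)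
    then show ?thesis by (auto simp: c_def perm_vec_def)
  qed
  then have "card {j. c $ i \<le> c $ j} = card {j. c $ i \<le> b $ j}"
    using permutes_inj[OF assms(3)] by (simp add: card_image inj_on_subset)
  finally show False by simp
qed

lemma perm_vec_comp: "perm_vec q (perm_vec p a) = perm_vec (p \<circ> q) a"
  by (simp add: perm_vec_def vec_eq_iff)

text \<open>Two sorted rearrangements dominate each other coordinatewise. The sorting permutation
  may vary when entries coincide, but the sorted vector does not, so the description in
  \<open>sort_desc\<close> is well defined.\<close>

lemma descending_perm_unique:
  fixes a :: "real^'n::{finite,linorder}"
  assumes "perm_vec p a \<in> descending" "perm_vec q a \<in> descending" "p permutes UNIV" "q permutes UNIV"
  shows "perm_vec p a = perm_vec q a"
proof -
  have *: "perm_vec q a $ i \<le> perm_vec p a $ i"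
    if "perm_vec p a \<in> descending" "perm_vec q a \<in> descending" "p permutes UNIV" "q permutes UNIV" for p q i
  proof -
    have "perm_vec q a = perm_vec (inv p \<circ> q) (perm_vec p a)"
      using permutes_inv_o(1)[OF that(3)] by (simp add: perm_vec_comp flip: o_assoc) (simp add: o_assoc)
    moreover have "inv p \<circ> q permutes UNIV"
      using that by (intro permutes_compose permutes_inv)
    ultimately show ?thesis using descending_perm_le[of "perm_vec p a" "inv p \<circ> q" i] that by simp
  qed
  show ?thesis unfolding vec_eq_iff using *[OF assms] *[OF assms(2,1,4,3)] by (auto intro: antisym)
qed

lemma sort_desc_eqI:
  fixes a :: "real^'n::{finite,linorder}"
  assumes "p permutes UNIV" "perm_vec p a \<in> descending"
  shows "sort_desc a = perm_vec p a"
  unfolding sort_desc_def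
proof (rule the_equality, goal_cases)
  case 1
  then show ?case using assms by (auto simp: perm_vec_def descending_def)
next
  case (2 b)
  then obtain q where "q permutes UNIV" "b = perm_vec q a" "b \<in> descending"
    by (auto simp: perm_vec_def descending_def)
  then show ?case using descending_perm_unique assms by blast
qed

lemma sort_desc_perm:
  fixes a :: "real^'n::{finite,linorder}"
  obtains p where "p permutes UNIV" "sort_desc a = perm_vec p a" "sort_desc a \<in> descending"
  using ex_sorting_perm[of a] sort_desc_eqI by metis

lemma Cfun_sort_desc: "Cfun (sort_desc a) = Cfun a"
  by (metis sort_desc_perm Cfun_perm_vec)

lemma Sfun_sort_desc: "Sfun (sort_desc a) = Sfun a"
  by (metis sort_desc_perm Sfun_perm_vec)

text \<open>The coordinate at \<open>Max UNIV\<close> is the smallest one of a descending vector, so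
  its positivity is positivity of all.\<close>

lemma Omega_d_eq: "Omega_d = pos_simplex \<inter> descending"
  unfolding Omega_d_def pos_simplex_def descending_def
  by (auto intro: order_less_le_trans)

lemma sort_desc_in_Omega_d: "a \<in> pos_simplex \<Longrightarrow> sort_desc a \<in> Omega_d"
  by (metis Omega_d_eq IntI sort_desc_perm perm_vec_pos_simplex)

lemma continuous_on_perm_vec: "continuous_on A (perm_vec p)"
  unfolding perm_vec_def by (intro continuous_intros)

lemma closed_descending: "closed descending"
  unfolding descending_def
  by (intro closed_Collect_all closed_Collect_imp closed_Collect_le continuous_intros) auto

text \<open>The space is a finite union of closed pieces, one per permutation, and on each piece
  sorting is that fixed permutation. This yields the measurability behind
  \<open>sorted_template_law\<close>.\<close>

lemma continuous_on_sort_desc: "continuous_on UNIV (sort_desc :: real^'n::{finite,linorder} \<Rightarrow> _)"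
proof -
  let ?P = "{p. p permutes (UNIV :: 'n set)}"
  let ?D = "\<lambda>p. perm_vec p -` (descending :: (real^'n::{finite,linorder}) set)"
  have "continuous_on (\<Union>p\<in>?P. ?D p) sort_desc"
  proof (rule continuous_on_closed_Union)
    show "finite ?P" by (simp add: finite_permutations)
    show "closed (?D p)" for p
      using continuous_closed_vimage[OF closed_descending] continuous_on_perm_vec
      by (metis closed_vimage closed_descending)
    show "continuous_on (?D p) sort_desc" if "p \<in> ?P" for p
      using that sort_desc_eqI
      by (subst continuous_on_cong[OF refl, of _ _ "perm_vec p"]) (auto intro: continuous_on_perm_vec)
  qed
  moreover have "(\<Union>p\<in>?P. ?D p) = UNIV" using ex_sorting_perm by auto
  ultimately show ?thesis by simp
qed

section \<open>The supporting line of the frontier\<close>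

text \<open>The set \<open>?T\<close> of points satisfying both claims is convex and contains
  \<open>S\<close>: a combination with two positive weights reaches the bound only if both of its
  end points do.\<close>

lemma convex_hull_supporting_face:
  fixes l :: "'a::real_vector \<Rightarrow> real"
  assumes "linear l" "\<And>x. x \<in> S \<Longrightarrow> l x \<le> b" "p \<in> convex hull S"
  shows "l p \<le> b" "l p = b \<Longrightarrow> p \<in> convex hull (S \<inter> {x. l x = b})"
proof -
  let ?F = "convex hull (S \<inter> {x. l x = b})"
  let ?T = "{p. l p \<le> b \<and> (l p = b \<longrightarrow> p \<in> ?F)}"
  have "convex ?T"
  proof (rule convexI)
    fix x y :: 'a and u v :: real
    assume xy: "x \<in> ?T" "y \<in> ?T" and uv: "0 \<le> u" "0 \<le> v" "u + v = 1"
    have lin: "l (u *\<^sub>R x + v *\<^sub>R y) = u * l x + v * l y"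
      using assms(1) by (simp add: linear_add linear_cmul)
    have b: "u * b + v * b = b" using uv(3) distrib_right[of u v b] by simp
    have le: "u * l x \<le> u * b" "v * l y \<le> v * b"
      using xy uv by (auto intro: mult_left_mono)
    have "u *\<^sub>R x + v *\<^sub>R y \<in> ?F" if eq: "u * l x + v * l y = b"
    \<comment> \<open>With a zero weight nothing is known about the corresponding point, but then
      the combination is the other point.\<close>
    proof (cases "u = 0 \<or> v = 0")
      case True
      then consider "u = 0" "v = 1" | "u = 1" "v = 0" using uv(3) by auto
      then show ?thesis by cases (use xy eq in auto)
    next
      case False
      have "u * l x = u * b" "v * l y = v * b" using le b eq by linarith+
      then have "x \<in> ?F" "y \<in> ?F" using False xy by auto
      then show ?thesis using uv by (intro convexD[OF convex_convex_hull])
    qed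
    moreover have "l (u *\<^sub>R x + v *\<^sub>R y) \<le> b" using le b lin by linarith
    ultimately show "u *\<^sub>R x + v *\<^sub>R y \<in> ?T" using lin by simp
  qed
  moreover have "S \<subseteq> ?T" using assms(2) by (auto intro: hull_inc)
  ultimately have "convex hull S \<subseteq> ?T" by (intro hull_minimal)
  then show "l p \<le> b" "l p = b \<Longrightarrow> p \<in> ?F" using assms(3) by auto
qed

text \<open>The projective change of coordinates \<open>(c, s) \<mapsto> (c, s) / (1 + c)\<close> compactifies the frontier:
  the whole boundary of the simplex, where \<open>c\<close> is infinite, goes to the single point \<open>(1, 0)\<close>.\<close>

definition proj_point :: "real^'n \<Rightarrow> real \<times> real" where
  "proj_point a = (if a \<in> pos_simplex then (Cfun a / (1 + Cfun a), Sfun a / (1 + Cfun a)) else (1, 0))"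

lemma compact_Kd: "compact (Kd :: (real^'n) set)"
proof -
  have "closed (Kd :: (real^'n) set)"
    unfolding Kd_def
    by (intro closed_Collect_conj closed_Collect_all closed_Collect_le closed_Collect_eq continuous_intros)
  moreover have "bounded (Kd :: (real^'n) set)"
    by (rule bounded_subset[OF bounded_cbox[of 0 "vec (real CARD('n))"]])
      (auto simp: mem_box_cart Kd_le_card Kd_nonneg)
  ultimately show ?thesis by (simp add: compact_eq_bounded_closed)
qed

text \<open>The distance to (1, 0) is at most \<open>(1 + Sfun a) / (1 + Cfun a)\<close>, where the
  numerator is bounded and the reciprocal of the denominator is controlled by any single
  coordinate.\<close>

lemma norm_proj_point_diff_le:
  fixes a :: "real^'n"
  assumes "a \<in> Kd" "2 \<le> CARD('n)"
  shows "norm (proj_point a - (1, 0)) \<le> (1 + real CARD('n) * (real CARD('n) - 1)) * (real CARD('n) * a $ k)"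
proof (cases "a \<in> pos_simplex")
  case True
  let ?d = "real CARD('n)"
  have C: "0 \<le> Cfun a" using Cfun_nonneg[OF True assms(2)] .
  have inv: "1 / (1 + Cfun a) \<le> ?d * a $ k" using inverse_one_plus_Cfun_le[OF True assms(2)] .
  have "norm (proj_point a - (1, 0)) \<le> norm (Cfun a / (1 + Cfun a) - 1) + norm (Sfun a / (1 + Cfun a))"
    using norm_Pair_le[of "Cfun a / (1 + Cfun a) - 1" "Sfun a / (1 + Cfun a)"] True
    by (simp add: proj_point_def)
  also have "Cfun a / (1 + Cfun a) - 1 = - (1 / (1 + Cfun a))" using C by (simp add: field_simps)
  also have "norm (- (1 / (1 + Cfun a))) + norm (Sfun a / (1 + Cfun a)) = (1 + Sfun a) * (1 / (1 + Cfun a))"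
    using C Sfun_nonneg[OF assms(1)] by (simp add: add_divide_distrib)
  also have "\<dots> \<le> (1 + ?d * (?d - 1)) * (?d * a $ k)"
    using Sfun_le[OF assms(1)] Sfun_nonneg[OF assms(1)] inv C by (intro mult_mono) auto
  finally show ?thesis .
next
  case False
  have "0 \<le> real CARD('n) * (real CARD('n) - 1)" using assms(2) by simp
  then show ?thesis using False Kd_nonneg[OF assms(1), of k] by (simp add: proj_point_def)
qed

text \<open>At positive points both components are rational functions with nonzero denominators. At
  a boundary point some coordinate k vanishes, and the distance bound for that k squeezes the values
  to (1, 0).\<close>

lemma continuous_on_proj_point:
  assumes "2 \<le> CARD('n)"
  shows "continuous_on (Kd :: (real^'n) set) proj_point"
  unfolding continuous_on_def
proof
  fix x :: "real^'n" assume x: "x \<in> Kd"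
  let ?F = "at x within Kd"
  have lim: "((\<lambda>y. y $ i) \<longlongrightarrow> x $ i) ?F" for i by (intro tendsto_intros)
  have Kd: "eventually (\<lambda>y. y \<in> Kd) ?F" by (simp add: eventually_at_filter)
  show "(proj_point \<longlongrightarrow> proj_point x) ?F"
  proof (cases "x \<in> pos_simplex")
    case True
    have "eventually (\<lambda>y. \<forall>i. 0 < y $ i) ?F"
      by (intro eventually_all_finite order_tendstoD(1)[OF lim] pos_simplex_pos[OF True])
    with Kd have "eventually (\<lambda>y. proj_point y = (Cfun y / (1 + Cfun y), Sfun y / (1 + Cfun y))) ?F"
      by eventually_elim (simp add: proj_point_def pos_simplex_def)
    moreover have "((\<lambda>y. (Cfun y / (1 + Cfun y), Sfun y / (1 + Cfun y))) \<longlongrightarrow> proj_point x) ?F"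
    proof -
      have B: "(Bfun \<longlongrightarrow> Bfun x) ?F" unfolding Bfun_def by (intro tendsto_intros)
      have A: "(Afun \<longlongrightarrow> Afun x) ?F" unfolding Afun_def
        using pos_simplex_pos[OF True] by (intro tendsto_intros) (metis less_irrefl)
      have C: "(Cfun \<longlongrightarrow> Cfun x) ?F" unfolding Cfun_def
        using assms by (intro tendsto_intros A B) simp
      have S: "(Sfun \<longlongrightarrow> Sfun x) ?F" unfolding Sfun_def by (intro tendsto_intros B)
      have "1 + Cfun x \<noteq> 0" using Cfun_nonneg[OF True assms] by simp
      then have "((\<lambda>y. (Cfun y / (1 + Cfun y), Sfun y / (1 + Cfun y)))
          \<longlongrightarrow> (Cfun x / (1 + Cfun x), Sfun x / (1 + Cfun x))) ?F"
        by (intro tendsto_intros C S)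
      then show ?thesis using True by (simp add: proj_point_def)
    qed
    ultimately show ?thesis by (rule iffD2[OF tendsto_cong])
  next
    case False
    then obtain k where "\<not> 0 < x $ k" using x by (auto simp: pos_simplex_def)
    then have k: "x $ k = 0" using Kd_nonneg[OF x, of k] by simp
    let ?d = "real CARD('n)"
    have "((\<lambda>y. (1 + ?d * (?d - 1)) * (?d * y $ k)) \<longlongrightarrow> (1 + ?d * (?d - 1)) * (?d * x $ k)) ?F"
      by (intro tendsto_intros)
    then have lim0: "((\<lambda>y. (1 + ?d * (?d - 1)) * (?d * y $ k)) \<longlongrightarrow> 0) ?F"
      unfolding k by (simp only: mult_zero_right)
    have "eventually (\<lambda>y. norm (proj_point y - (1, 0)) \<le> (1 + ?d * (?d - 1)) * (?d * y $ k)) ?F"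
      using Kd by eventually_elim (rule norm_proj_point_diff_le[OF _ assms])
    then have "((\<lambda>y. proj_point y - (1, 0)) \<longlongrightarrow> 0) ?F"
      by (rule Lim_null_comparison[OF _ lim0])
    moreover have "proj_point x = (1, 0)" using False by (simp add: proj_point_def)
    ultimately show ?thesis by (simp add: LIM_zero_iff)
  qed
qed

text \<open>A vertex serves; it puts (1, 0) into the compactified image.\<close>

lemma ex_boundary_point:
  assumes "2 \<le> CARD('n)"
  shows "\<exists>a \<in> (Kd :: (real^'n) set). a \<notin> pos_simplex"
proof -
  fix k :: 'n
  let ?a = "(\<chi> i. if i = k then real CARD('n) else 0) :: real^'n"
  have a: "?a \<in> Kd" by (simp add: Kd_def)
  have "?a \<notin> pos_simplex"
  proof
    assume "?a \<in> pos_simplex"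
    from pos_simplex_less_card[OF this assms, of k] show False by simp
  qed
  with a show ?thesis by blast
qed

section \<open>Separation in projective coordinates and the optimal pair\<close>

lemma ex_convex_combination_between:
  fixes x y z :: real
  assumes "x \<le> z" "z \<le> y"
  shows "\<exists>t\<in>{0..1}. t * x + (1 - t) * y = z"
proof (cases "x = y")
  case False
  then have "x < y" using assms by simp
  then have "(y - z) / (y - x) * (y - x) = y - z" by simp
  then have "(y - z) / (y - x) * x + (1 - (y - z) / (y - x)) * y = z"
    by (simp only: algebra_simps)
  moreover have "(y - z) / (y - x) \<in> {0..1}" using assms \<open>x < y\<close> by auto
  ultimately show ?thesis by blast
qed (use assms in \<open>auto intro!: bexI[of _ 0]\<close>)

text \<open>In projective coordinates the hull of the image is compact, so it has a highest point
  above the image \<open>p0\<close> of \<open>c0\<close>. A line separating the hull from the ray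
  above that point pulls back to the required line. The highest point lies in the hull of the
  contact set, so contact occurs on both sides.\<close>

lemma supporting_line:
  assumes "2 \<le> CARD('n)" "0 < c0"
  shows "\<exists>f l. 0 < l \<and> (\<forall>x\<in>(pos_simplex :: (real^'n) set). Sfun x \<le> f + l * (Cfun x - c0))
    \<and> (\<exists>a\<in>(pos_simplex :: (real^'n) set). Sfun a = f + l * (Cfun a - c0) \<and> Cfun a \<le> c0)
    \<and> (\<exists>a\<in>(pos_simplex :: (real^'n) set). Sfun a = f + l * (Cfun a - c0) \<and> c0 \<le> Cfun a)"
proof -
  define K where "K = proj_point ` (Kd :: (real^'n) set)"
  define p0 where "p0 = c0 / (1 + c0)"
  have p0: "0 < p0" "p0 < 1" "(1 - p0) * (1 + c0) = 1"
    using assms(2) by (auto simp: p0_def field_simps)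
  have compact: "compact (convex hull K)"
    unfolding K_def by (intro compact_convex_hull compact_continuous_image continuous_on_proj_point compact_Kd assms)
  have K0: "(0, 0) \<in> K"
    unfolding K_def using one_in_pos_simplex
    by (intro image_eqI[of _ _ 1]) (auto simp: proj_point_def Cfun_one Sfun_one pos_simplex_Kd)
  have K1: "(1, 0) \<in> K"
    using ex_boundary_point[OF assms(1)] by (force simp: K_def proj_point_def)
  have K_cases: "q = (1, 0) \<or> (\<exists>a\<in>(pos_simplex :: (real^'n) set). q = (Cfun a / (1 + Cfun a), Sfun a / (1 + Cfun a)))"
    if "q \<in> K" for q using that by (auto simp: K_def proj_point_def)
  have K_pos: "(Cfun a / (1 + Cfun a), Sfun a / (1 + Cfun a)) \<in> K" if "a \<in> pos_simplex" for a :: "real^'n"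
    using that unfolding K_def by (intro image_eqI[of _ _ a]) (auto simp: proj_point_def pos_simplex_Kd)
  define T where "T = snd ` (convex hull K \<inter> {q. fst q = p0})"
  have "closed {q :: real \<times> real. fst q = p0}"
    by (intro closed_Collect_eq continuous_intros)
  then have "compact T"
    unfolding T_def by (intro compact_continuous_image compact_Int_closed compact continuous_intros)
  \<comment> \<open>The segment from (0, 0) to (1, 0) crosses the vertical line at
    \<open>p0\<close>, so the slice \<open>T\<close> is nonempty.\<close>
  moreover have "(1 - p0) *\<^sub>R (0, 0) + p0 *\<^sub>R (1, 0) \<in> convex hull K"
    using K0 K1 p0 by (intro convexD[OF convex_convex_hull] hull_inc) auto
  then have "T \<noteq> {}" by (auto simp: T_def)
  ultimately obtain m where mT: "m \<in> T" and m_max: "\<And>z. z \<in> T \<Longrightarrow> z \<le> m"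
    using compact_attains_sup[of T] by blast
  have m: "(p0, m) \<in> convex hull K" using mT by (auto simp: T_def)
  have "convex hull K \<inter> ({p0} \<times> {m<..}) = {}"
    using m_max by (force simp: T_def)
  then obtain w b where w: "w \<noteq> 0" and wK: "\<And>q. q \<in> convex hull K \<Longrightarrow> w \<bullet> q \<le> b"
    and wR: "\<And>q. q \<in> {p0} \<times> {m<..} \<Longrightarrow> b \<le> w \<bullet> q"
  proof -
    have "convex ({p0} \<times> {m<..})" by (intro convex_Times) simp_all
    moreover have "{p0} \<times> {m<..} \<noteq> {}" by (auto intro: exI[of _ "m + 1"])
    moreover have "convex hull K \<noteq> {}" using m by blast
    ultimately show thesis
      using separating_hyperplane_sets[of "convex hull K" "{p0} \<times> {m<..}"]
        \<open>convex hull K \<inter> ({p0} \<times> {m<..}) = {}\<close> that by blast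
  qed
  obtain u v where uv: "w = (u, v)" by (cases w)
  have K': "u * y + v * z \<le> b" if "(y, z) \<in> convex hull K" for y z
    using wK[OF that] by (simp add: uv)
  have R: "b \<le> u * p0 + v * z" if "m < z" for z
    using wR[of "(p0, z)"] that by (simp add: uv)
  have "0 \<le> v" using R[of "m + 1"] K'[OF m] by (simp add: algebra_simps)
  \<comment> \<open>A vertical separating line would have \<open>p0\<close> on one side and both 0
    and 1 on the other, but \<open>p0\<close> lies strictly between them.\<close>
  moreover have "v \<noteq> 0"
  proof
    assume v: "v = 0"
    have "0 \<le> b" "u \<le> b" using K'[OF hull_inc[OF K0]] K'[OF hull_inc[OF K1]] v by auto
    moreover have "b \<le> u * p0" using R[of "m + 1"] v by simp
    moreover have "u \<noteq> 0" using w uv v by (auto simp: zero_prod_def)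
    moreover have "u * p0 < u" if "0 < u" using p0 that by simp
    moreover have "u * p0 < 0" if "u < 0" using p0 that by (simp add: mult_neg_pos)
    ultimately show False by linarith
  qed
  ultimately have v: "0 < v" by simp
  \<comment> \<open>Letting the ray point descend to \<open>m\<close> shows that the separating line
    passes through \<open>(p0, m)\<close>.\<close>
  have b: "b \<le> u * p0 + v * m"
  proof (rule field_le_epsilon)
    fix e :: real assume "0 < e"
    then show "b \<le> u * p0 + v * m + e" using R[of "m + e / v"] v by (simp add: algebra_simps)
  qed
  define n where "n = - u / v"
  have vn: "v * n = - u" using v by (simp add: n_def)
  have line: "z \<le> m + n * (y - p0)" if "(y, z) \<in> K" for y z
  proof -
    have "v * (m + n * (y - p0)) = v * m - u * (y - p0)"
      unfolding distrib_left mult.assoc[symmetric] vn by simp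
    then have "v * z \<le> v * (m + n * (y - p0))"
      using K'[OF hull_inc[OF that]] b by (simp add: algebra_simps)
    then show ?thesis using v by simp
  qed
  \<comment> \<open>Multiplying by \<open>1 + c\<close> undoes the projective change:
    \<open>f\<close> is the height of the pulled-back line at \<open>c0\<close>. Its slope
    \<open>l\<close> is the height of the projective line at abscissa 1.\<close>
  define f where "f = m * (1 + c0)"
  define l where "l = m + n * (1 - p0)"
  have scale: "(m + n * (C / (1 + C) - p0)) * (1 + C) = f + l * (C - c0)" if "0 \<le> C" for C
  proof -
    have "(m + n * (C / (1 + C) - p0)) * (1 + C) = m * (1 + C) + n * (C - p0 * (1 + C))"
      using that by (simp add: field_simps)
    also have "\<dots> = f + l * (C - c0) - n * (p0 * (1 + c0) - c0)"
      by (simp add: f_def l_def algebra_simps)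
    also have "p0 * (1 + c0) = c0" using p0(3) by (simp add: algebra_simps)
    finally show ?thesis by simp
  qed
  have below: "Sfun a \<le> f + l * (Cfun a - c0)" if "a \<in> pos_simplex" for a :: "real^'n"
    using line[OF K_pos[OF that]] scale[of "Cfun a"] Cfun_nonneg[OF that assms(1)]
    by (simp add: pos_divide_le_eq)
  define D where "D = real CARD('n) * (real CARD('n) - 1)"
  \<comment> \<open>This line is the projective image of the horizontal line \<open>s = D\<close>;
    by the strict bound on \<open>Sfun\<close> it meets \<open>K\<close> only at (1, 0).\<close>
  have top: "snd q + D * fst q \<le> D \<and> (snd q + D * fst q = D \<longrightarrow> q = (1, 0))" if q: "q \<in> K" for q
  proof (cases "q = (1, 0)")
    case False
    then obtain a :: "real^'n" where a: "a \<in> pos_simplex" "q = (Cfun a / (1 + Cfun a), Sfun a / (1 + Cfun a))"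
      using K_cases[OF q] by blast
    have "Sfun a / (1 + Cfun a) + D * (Cfun a / (1 + Cfun a)) = (Sfun a + D * Cfun a) / (1 + Cfun a)"
      by (simp add: add_divide_distrib)
    also have "\<dots> < D"
      using Sfun_less[OF a(1) assms(1)] Cfun_nonneg[OF a(1) assms(1)]
      by (simp add: pos_divide_less_eq distrib_left flip: D_def)
    finally have "Sfun a / (1 + Cfun a) + D * (Cfun a / (1 + Cfun a)) < D" .
    then show ?thesis using a(2) by simp
  qed simp
  have lin_top: "linear (\<lambda>q :: real \<times> real. snd q + D * fst q)"
    by (rule linearI) (auto simp: algebra_simps)
  \<comment> \<open>Equality would put \<open>(p0, m)\<close> into the hull of the single point (1,
    0), against \<open>p0 < 1\<close>.\<close>
  have "m + D * p0 \<noteq> D"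
  proof
    assume "m + D * p0 = D"
    then have "(p0, m) \<in> convex hull (K \<inter> {q. snd q + D * fst q = D})"
      using convex_hull_supporting_face(2)[OF lin_top _ m, of D] top by simp
    also have "\<dots> \<subseteq> convex hull {(1, 0)}" using top by (intro hull_mono) blast
    finally show False using p0 by simp
  qed
  then have "m < D * (1 - p0)"
    using convex_hull_supporting_face(1)[OF lin_top _ m, of D] top by (simp add: algebra_simps)
  then have "m * (1 + c0) < D * (1 - p0) * (1 + c0)"
    using assms(2) by (intro mult_strict_right_mono) auto
  then have "f < D" unfolding mult.assoc[of _ "1 - p0"] p0(3) by (simp add: f_def)
  then obtain a :: "real^'n" where "a \<in> pos_simplex" "f < Sfun a"
    unfolding D_def using Sfun_approaches_bound assms(1) by blast
  \<comment> \<open>Slope 0 would cap \<open>Sfun\<close> by \<open>f\<close>, yet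
    \<open>f < D\<close> and \<open>Sfun\<close> comes arbitrarily close to
    \<open>D\<close>.\<close>
  then have "l \<noteq> 0" using below by fastforce
  moreover have "0 \<le> l" using line[OF K1] by (simp add: l_def)
  ultimately have l: "0 < l" by simp
  \<comment> \<open>The contact set. Its hull contains \<open>(p0, m)\<close>, so it lies in neither
    open half-plane beside the vertical line at \<open>p0\<close>.\<close>
  define G where "G = K \<inter> {q. snd q - n * fst q = m - n * p0}"
  have "(p0, m) \<in> convex hull G"
    unfolding G_def using line
    by (intro convex_hull_supporting_face(2)[OF _ _ m] linearI) (auto simp: algebra_simps)
  moreover have "convex {q :: real \<times> real. p0 < fst q}" "convex {q :: real \<times> real. fst q < p0}"
    using convex_linear_vimage[OF linear_fst, of "{p0<..}"] convex_linear_vimage[OF linear_fst, of "{..<p0}"]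
    by (simp_all add: vimage_def)
  ultimately have "\<not> G \<subseteq> {q. p0 < fst q}" "\<not> G \<subseteq> {q. fst q < p0}"
    using hull_minimal by fastforce+
  then obtain q q' where q: "q \<in> G" "fst q \<le> p0" "q' \<in> G" "p0 \<le> fst q'"
    by (metis (mono_tags, lifting) mem_Collect_eq not_le subsetI)
  have G: "\<exists>a\<in>(pos_simplex :: (real^'n) set). q = (Cfun a / (1 + Cfun a), Sfun a / (1 + Cfun a))
      \<and> Sfun a = f + l * (Cfun a - c0)" if "q \<in> G" for q
  proof -
    have "q \<in> K" using that by (simp add: G_def)
    \<comment> \<open>The line has height \<open>l > 0\<close> at abscissa 1, so contact points come
      from the positive simplex.\<close>
    have "q \<noteq> (1, 0)"
    proof
      assume "q = (1, 0)"
      then have "l = 0" using that by (simp add: G_def l_def algebra_simps)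
      then show False using l by simp
    qed
    then obtain a :: "real^'n" where a: "a \<in> pos_simplex" "q = (Cfun a / (1 + Cfun a), Sfun a / (1 + Cfun a))"
      using K_cases[OF \<open>q \<in> K\<close>] by blast
    have "Sfun a / (1 + Cfun a) = m + n * (Cfun a / (1 + Cfun a) - p0)"
      using that a(2) by (simp add: G_def algebra_simps)
    then have "Sfun a = f + l * (Cfun a - c0)"
      using scale[of "Cfun a"] Cfun_nonneg[OF a(1) assms(1)]
      by (subst (asm) nonzero_divide_eq_eq) auto
    then show ?thesis using a by blast
  qed
  have mono: "x / (1 + x) \<le> y / (1 + y) \<longleftrightarrow> x \<le> y" if "0 \<le> x" "0 \<le> y" for x y :: real
    using that by (simp add: field_simps)
  obtain a a' :: "real^'n" where
    "a \<in> pos_simplex" "Sfun a = f + l * (Cfun a - c0)" "Cfun a \<le> c0"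
    "a' \<in> pos_simplex" "Sfun a' = f + l * (Cfun a' - c0)" "c0 \<le> Cfun a'"
  proof -
    obtain a :: "real^'n" where a: "a \<in> pos_simplex" "q = (Cfun a / (1 + Cfun a), Sfun a / (1 + Cfun a))"
      "Sfun a = f + l * (Cfun a - c0)" using G[OF q(1)] by blast
    obtain a' :: "real^'n" where a': "a' \<in> pos_simplex" "q' = (Cfun a' / (1 + Cfun a'), Sfun a' / (1 + Cfun a'))"
      "Sfun a' = f + l * (Cfun a' - c0)" using G[OF q(3)] by blast
    have "Cfun a \<le> c0" "c0 \<le> Cfun a'"
      using q(2,4) mono Cfun_nonneg[OF a(1) assms(1)] Cfun_nonneg[OF a'(1) assms(1)] assms(2)
      by (simp_all add: a(2) a'(2) p0_def)
    then show thesis using that a a' by blast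
  qed
  then show ?thesis using l below by blast
qed

text \<open>Contact points on either side of \<open>c0\<close> can be mixed to abscissa
  \<open>c0\<close>; as both lie on the line, the mixture has height \<open>f\<close>. Sorting moves
  them into \<open>Omega_d\<close> without changing either functional.\<close>

lemma optimal_pair:
  assumes "2 \<le> CARD('n::{finite,linorder})" "0 \<le> c0"
  obtains f l t and a b :: "real^'n::{finite,linorder}" where
    "0 < l" "\<And>x :: real^'n::{finite,linorder}. x \<in> pos_simplex \<Longrightarrow> Sfun x \<le> f + l * (Cfun x - c0)"
    "a \<in> Omega_d" "b \<in> Omega_d" "t \<in> {0..1}"
    "t * Cfun a + (1 - t) * Cfun b = c0" "t * Sfun a + (1 - t) * Sfun b = f"
proof (cases "c0 = 0")
  case True
  have one: "(1 :: real^'n::{finite,linorder}) \<in> Omega_d"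
    using one_in_pos_simplex by (simp add: Omega_d_eq descending_def)
  \<comment> \<open>For budget 0 the all-ones vector, where both functionals vanish, is the contact
    point, with the slope from \<open>Sfun_le_Cfun\<close>.\<close>
  show ?thesis
  proof (rule that[where f = 0 and t = 0 and a = 1 and b = 1])
    show "0 < real CARD('n) * (real CARD('n) - 1) / 2" using assms(1) by simp
    show "Sfun x \<le> 0 + real CARD('n) * (real CARD('n) - 1) / 2 * (Cfun x - c0)"
      if "x \<in> pos_simplex" for x :: "real^'n::{finite,linorder}"
      using Sfun_le_Cfun[OF that assms(1)] True by simp
    show "0 * Cfun (1 :: real^'n::{finite,linorder}) + (1 - 0) * Cfun (1 :: real^'n::{finite,linorder}) = c0"
      using True by (simp add: Cfun_one)
    show "0 * Sfun (1 :: real^'n::{finite,linorder}) + (1 - 0) * Sfun (1 :: real^'n::{finite,linorder}) = 0"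
      by (simp add: Sfun_one)
  qed (use one in simp_all)
next
  case False
  then obtain f l and a b :: "real^'n::{finite,linorder}" where *:
    "0 < l" "\<And>x :: real^'n::{finite,linorder}. x \<in> pos_simplex \<Longrightarrow> Sfun x \<le> f + l * (Cfun x - c0)"
    "a \<in> pos_simplex" "Sfun a = f + l * (Cfun a - c0)" "Cfun a \<le> c0"
    "b \<in> pos_simplex" "Sfun b = f + l * (Cfun b - c0)" "c0 \<le> Cfun b"
    using supporting_line[of c0, where 'n = 'n] assms by (metis order_le_less)
  obtain t where t: "t \<in> {0..1}" "t * Cfun a + (1 - t) * Cfun b = c0"
    using ex_convex_combination_between[OF *(5,8)] by blast
  have "t * Sfun a + (1 - t) * Sfun b = f + l * (t * Cfun a + (1 - t) * Cfun b - c0)"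
    unfolding *(4,7) by (simp add: algebra_simps)
  also have "\<dots> = f" using t(2) by simp
  finally have S: "t * Sfun a + (1 - t) * Sfun b = f" .
  show ?thesis
    by (rule that[of l f "sort_desc a" "sort_desc b" t])
      (use t(1) in \<open>simp_all only: *(1-3,6) t(2) S sort_desc_in_Omega_d Cfun_sort_desc Sfun_sort_desc\<close>)
qed

text \<open>The half-plane below the line contains \<open>Gamma_d\<close> and hence its hull; as
  \<open>l > 0\<close>, abscissae up to \<open>c0\<close> give heights up to \<open>f\<close>,
  attained by the mixture.\<close>

lemma Sup_hull_Gamma_d:
  fixes a b :: "real^'n::{finite,linorder}"
  assumes "0 < l" "\<And>x :: real^'n::{finite,linorder}. x \<in> pos_simplex \<Longrightarrow> Sfun x \<le> f + l * (Cfun x - c0)"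
    "a \<in> Omega_d" "b \<in> Omega_d" "t \<in> {0..1}"
    "t * Cfun a + (1 - t) * Cfun b = c0" "t * Sfun a + (1 - t) * Sfun b = f"
  shows "Sup {s. \<exists>c. (c, s) \<in> convex hull (Gamma_d TYPE('n)) \<and> c \<le> c0} = f"
proof (rule cSup_eq_maximum)
  have "t *\<^sub>R (Cfun a, Sfun a) + (1 - t) *\<^sub>R (Cfun b, Sfun b) \<in> convex hull (Gamma_d TYPE('n))"
    using assms(3-5) by (intro convexD[OF convex_convex_hull] hull_inc) (auto simp: Gamma_d_def)
  then show "f \<in> {s. \<exists>c. (c, s) \<in> convex hull (Gamma_d TYPE('n)) \<and> c \<le> c0}"
    using assms(6,7) by auto
next
  fix s assume "s \<in> {s. \<exists>c. (c, s) \<in> convex hull (Gamma_d TYPE('n)) \<and> c \<le> c0}"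
  then obtain c where c: "(c, s) \<in> convex hull (Gamma_d TYPE('n))" "c \<le> c0" by blast
  have "snd (c, s) - l * fst (c, s) \<le> f - l * c0"
  proof (rule convex_hull_supporting_face(1)[OF _ _ c(1)])
    show "linear (\<lambda>q :: real \<times> real. snd q - l * fst q)"
      by (rule linearI) (auto simp: algebra_simps)
    fix q assume "q \<in> Gamma_d TYPE('n)"
    then obtain x :: "real^'n::{finite,linorder}" where x: "x \<in> pos_simplex" "q = (Cfun x, Sfun x)"
      by (auto simp: Gamma_d_def Omega_d_eq)
    then show "snd q - l * fst q \<le> f - l * c0"
      using assms(2)[OF x(1)] by (simp add: right_diff_distrib)
  qed
  moreover have "l * c \<le> l * c0" using assms(1) c(2) by simp
  ultimately show "s \<le> f" by simp
qed

section \<open>Anchored laws\<close>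

lemma borel_measurable_Cfun [measurable]: "Cfun \<in> borel_measurable borel"
  and borel_measurable_Sfun [measurable]: "Sfun \<in> borel_measurable borel"
proof -
  have [measurable]: "(\<lambda>a :: real^'n. a $ i) \<in> borel_measurable borel" for i
    by (intro borel_measurable_continuous_onI continuous_intros)
  show "Cfun \<in> borel_measurable borel" "Sfun \<in> borel_measurable borel"
    unfolding Cfun_def[abs_def] Sfun_def[abs_def] Afun_def Bfun_def by measurable
qed

text \<open>Column j of \<open>perm_mat p\<close> is the unit vector at \<open>p j\<close>, so
  coordinate i of the product reads \<open>u\<close> at \<open>inv p i\<close>.\<close>

lemma perm_mat_mult: "p permutes UNIV \<Longrightarrow> perm_mat p *v u = perm_vec (inv p) u"
proof -
  assume p: "p permutes UNIV"
  have "(\<Sum>j\<in>UNIV. (if i = p j then 1 else 0) * u $ j) = u $ inv p i" for i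
  proof -
    have "(\<Sum>j\<in>UNIV. (if i = p j then 1 else 0) * u $ j) = (\<Sum>j\<in>UNIV. if j = inv p i then u $ j else 0)"
      by (rule sum.cong) (auto simp: permutes_inverses[OF p])
    then show ?thesis by simp
  qed
  then show ?thesis by (simp add: vec_eq_iff perm_mat_def perm_vec_def matrix_vector_mult_def)
qed

text \<open>First move i to k, then correct the image of j by a transposition that leaves k fixed.
  This two-point transitivity makes all pair integrals of an exchangeable law agree.\<close>

lemma ex_perm_two_points:
  assumes "i \<noteq> j" "k \<noteq> l"
  shows "\<exists>p. p permutes (UNIV :: 'a set) \<and> p i = k \<and> p j = l"
proof -
  define q where "q = Transposition.transpose i k"
  define p where "p = Transposition.transpose (q j) l \<circ> q"
  have "q i = k" "q j \<noteq> k" using assms(1) by (auto simp: q_def Transposition.transpose_def)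
  then have "p i = k" "p j = l" using assms(2) by (auto simp: p_def)
  moreover have "p permutes UNIV"
    unfolding p_def q_def by (intro permutes_compose permutes_swap_id) auto
  ultimately show ?thesis by blast
qed

definition off_diag :: "('n::finite \<times> 'n) set" where
  "off_diag = {(i, j). i \<noteq> j}"

lemma card_off_diag: "real (card (off_diag :: ('n::finite \<times> 'n) set)) = real CARD('n) * (real CARD('n) - 1)"
proof -
  let ?R = "range (\<lambda>i :: 'n. (i, i))"
  have "(off_diag :: ('n \<times> 'n) set) = UNIV \<times> UNIV - ?R"
    by (auto simp: off_diag_def)
  moreover have "card (UNIV \<times> UNIV - ?R) = card (UNIV \<times> UNIV :: ('n \<times> 'n) set) - card ?R"
    by (rule card_Diff_subset) auto
  moreover have "card ?R = CARD('n)" by (rule card_image) (simp add: inj_on_def)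
  ultimately have "card (off_diag :: ('n \<times> 'n) set) = CARD('n) * CARD('n) - CARD('n)"
    by (simp only: card_cartesian_product)
  then show ?thesis by (simp add: of_nat_diff right_diff_distrib)
qed

lemma sum_off_diag:
  fixes F :: "'n::finite \<Rightarrow> 'n \<Rightarrow> 'b::comm_monoid_add"
  assumes "\<And>i. F i i = 0"
  shows "(\<Sum>(i, j)\<in>off_diag. F i j) = (\<Sum>i\<in>UNIV. \<Sum>j\<in>UNIV. F i j)"
  unfolding sum.cartesian_product
  by (rule sum.mono_neutral_left) (auto simp: off_diag_def assms)

section \<open>The integrands of \<open>chi_star\<close> and the support set\<close>

lemma chi_star_le_iff:
  fixes H :: "real^'m^'n"
  assumes "2 \<le> CARD('n)"
  shows "chi_star H \<rho> \<le> c \<longleftrightarrow> (\<forall>(i, j)\<in>off_diag. (\<integral>\<^sup>+ x. chi_integrand H i j x \<partial>\<rho>) \<le> c)"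
proof -
  let ?I = "\<lambda>(i, j). \<integral>\<^sup>+ x. chi_integrand H i j x \<partial>\<rho>"
  have "chi_star H \<rho> = Max (?I ` off_diag)"
    unfolding chi_star_def off_diag_def by (rule arg_cong[where f = Max]) auto
  moreover have "(off_diag :: ('n \<times> 'n) set) \<noteq> {}"
  proof
    assume "(off_diag :: ('n \<times> 'n) set) = {}"
    then have "real CARD('n) * (real CARD('n) - 1) = 0" using card_off_diag[where 'n = 'n] by simp
    then show False using assms by simp
  qed
  moreover have "finite (off_diag :: ('n \<times> 'n) set)" by simp
  ultimately show ?thesis by (simp add: Max_le_iff case_prod_unfold)
qed

lemma chi_integrand_template:
  "chi_integrand H i j x = (if template H x $ i = 0 then (if template H x $ j = 0 then 0 else \<infinity>)
     else ennreal ((template H x $ j - template H x $ i)\<^sup>2 / template H x $ i))"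
proof -
  have *: "(H $ j - H $ i) \<bullet> x = template H x $ j - template H x $ i" "1 + (H $ i) \<bullet> x = template H x $ i"
    by (simp_all add: template_def matrix_vector_mul_component inner_diff_left)
  show ?thesis unfolding chi_integrand_def Let_def * by auto
qed

lemma borel_measurable_chi_integrand [measurable]: "chi_integrand H i j \<in> borel_measurable borel"
  unfolding chi_integrand_def[abs_def] Let_def by measurable

lemma continuous_on_template: "continuous_on A (template H)"
  unfolding template_def
  by (intro continuous_intros matrix_vector_mult_linear_continuous_on)

lemma borel_measurable_template [measurable]: "template H \<in> borel_measurable borel"
  by (intro borel_measurable_continuous_onI continuous_on_template)

lemma closed_Xd: "closed (Xd H)"
  unfolding Xd_def by (intro closed_Collect_all closed_Collect_le continuous_intros)

lemma sets_Xd [measurable]: "Xd H \<in> sets borel"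
  using closed_Xd by (rule borel_closed)

lemma borel_measurable_matrix_mult [measurable]: "(\<lambda>x :: real^'m. A *v x) \<in> borel_measurable borel"
  by (intro borel_measurable_continuous_onI matrix_vector_mult_linear_continuous_on)

lemma anchored_AE_Xd:
  assumes "anchored H \<rho>"
  shows "AE x in \<rho>. x \<in> Xd H"
proof -
  interpret prob_space \<rho> using assms by (simp add: anchored_def)
  have "prob (Xd H) = 1" using assms by (simp add: anchored_def measure_def)
  moreover have "Xd H \<in> events" using assms by (simp add: anchored_def)
  ultimately show ?thesis using prob_eq_1 by simp
qed

section \<open>Templates and permutations in a centred orthonormal frame\<close>

locale centred_frame =
  fixes H :: "real^'m^'n"
  assumes card_ge_2: "2 \<le> CARD('n)"
    and orthonormal: "transpose H ** H = mat 1"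
    and range: "range (\<lambda>x. H *v x) = {u. (\<Sum>i\<in>UNIV. u $ i) = 0}"
begin

lemma sum_mult: "(\<Sum>i\<in>UNIV. (H *v x) $ i) = 0"
  using range by blast

lemma transpose_mult_mult: "transpose H *v (H *v x) = x"
  by (simp add: matrix_vector_mul_assoc orthonormal)

lemma mult_transpose_mult: "(\<Sum>i\<in>UNIV. u $ i) = 0 \<Longrightarrow> H *v (transpose H *v u) = u"
proof -
  assume "(\<Sum>i\<in>UNIV. u $ i) = 0"
  then obtain x where "u = H *v x" using range by blast
  then show ?thesis by (simp only: transpose_mult_mult)
qed

lemma template_inject: "template H x = template H y \<Longrightarrow> x = y"
  by (metis add_left_cancel template_def transpose_mult_mult)

lemma template_in_Kd_iff: "template H x \<in> Kd \<longleftrightarrow> x \<in> Xd H"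
  using sum_mult[of x] by (simp add: Kd_def Xd_def template_def matrix_vector_mul_component sum.distrib)

lemma template_xa: "a \<in> Kd \<Longrightarrow> template H (xa H a) = a"
  using mult_transpose_mult[of "a - vec 1"] Kd_sum[of a]
  by (simp add: template_def xa_def sum_subtractf)

text \<open>Orthonormal columns make \<open>H\<close> an isometry, and \<open>H *v x\<close> is the
  template minus the all-ones vector.\<close>

lemma inner_self_eq_Sfun: "x \<in> Xd H \<Longrightarrow> x \<bullet> x = Sfun (template H x)"
proof -
  assume x: "x \<in> Xd H"
  have "x \<bullet> x = (transpose H *v (H *v x)) \<bullet> x" by (simp only: transpose_mult_mult)
  also have "\<dots> = (H *v x) \<bullet> (H *v x)" by (simp only: transpose_matrix_vector dot_lmul_matrix)
  also have "\<dots> = Sfun (template H x)"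
    using x by (simp add: Sfun_eq_sum_squares template_in_Kd_iff)
      (simp add: template_def inner_vec_def power2_eq_square)
  finally show ?thesis .
qed

text \<open>A permuted \<open>H *v x\<close> still sums to zero, so \<open>H ** transpose H\<close>
  fixes it.\<close>

lemma template_Pmat:
  assumes "p permutes UNIV"
  shows "template H (Pmat H p *v x) = perm_vec (inv p) (template H x)"
proof -
  have "Pmat H p *v x = transpose H *v (perm_vec (inv p) (H *v x))"
    by (simp add: Pmat_def perm_mat_mult[OF assms] flip: matrix_vector_mul_assoc)
  moreover have "(\<Sum>i\<in>UNIV. perm_vec (inv p) (H *v x) $ i) = 0"
    using sum_perm_vec[OF permutes_inv[OF assms], of "\<lambda>x. x"] sum_mult by simp
  ultimately have "H *v (Pmat H p *v x) = perm_vec (inv p) (H *v x)"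
    by (simp only: mult_transpose_mult)
  then show ?thesis by (simp add: template_def vec_eq_iff perm_vec_def)
qed

lemma Pmat_comp:
  assumes "p permutes UNIV" "q permutes UNIV"
  shows "Pmat H p *v (Pmat H q *v x) = Pmat H (p \<circ> q) *v x"
  by (rule template_inject)
    (simp add: template_Pmat assms permutes_compose perm_vec_comp
      o_inv_distrib[OF permutes_bij[OF assms(1)] permutes_bij[OF assms(2)]])

lemma chi_integrand_Pmat:
  assumes "p permutes UNIV"
  shows "chi_integrand H i j (Pmat H p *v x) = chi_integrand H (inv p i) (inv p j) x"
  by (simp add: chi_integrand_template template_Pmat[OF assms] perm_vec_def)

lemma sum_chi_integrand:
  assumes "template H x \<in> pos_simplex"
  shows "(\<Sum>(i, j)\<in>off_diag. chi_integrand H i j x)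
    = ennreal (real CARD('n) * (real CARD('n) - 1) * Cfun (template H x))"
proof -
  let ?a = "template H x"
  have pos: "0 < ?a $ i" for i using pos_simplex_pos[OF assms] .
  have "(\<Sum>(i, j)\<in>off_diag. chi_integrand H i j x) = (\<Sum>(i, j)\<in>off_diag. ennreal ((?a $ j - ?a $ i)\<^sup>2 / ?a $ i))"
    using pos by (intro sum.cong) (auto simp: chi_integrand_template less_imp_neq[symmetric])
  also have "\<dots> = ennreal (\<Sum>(i, j)\<in>off_diag. (?a $ j - ?a $ i)\<^sup>2 / ?a $ i)"
    using pos by (subst sum_ennreal[symmetric]) (auto simp: case_prod_unfold less_imp_le)
  also have "(\<Sum>(i, j)\<in>off_diag. (?a $ j - ?a $ i)\<^sup>2 / ?a $ i)
      = real CARD('n) * (real CARD('n) - 1) * Cfun ?a"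
    unfolding Cfun_eq_pair_sum[OF assms card_ge_2] by (rule sum_off_diag) simp
  finally show ?thesis .
qed

text \<open>If coordinate i of the template vanished, some other coordinate j would not, since the
  sum is d; the pair (i, j) would then contribute infinity.\<close>

lemma pos_simplexI_chi:
  assumes "x \<in> Xd H" "(\<Sum>(i, j)\<in>off_diag. chi_integrand H i j x) \<noteq> \<infinity>"
  shows "template H x \<in> pos_simplex"
proof -
  let ?a = "template H x"
  have K: "?a \<in> Kd" using assms(1) template_in_Kd_iff by blast
  have "?a $ i \<noteq> 0" for i
  proof
    assume i: "?a $ i = 0"
    obtain j where j: "?a $ j \<noteq> 0"
    proof (rule ccontr)
      assume "\<not> thesis"
      then have "\<forall>j. ?a $ j = 0" using that by blast
      then show False using Kd_sum[OF K] by simp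
    qed
    then have "(i, j) \<in> off_diag" using i by (auto simp: off_diag_def)
    then have "chi_integrand H i j x \<le> (\<Sum>(i, j)\<in>off_diag. chi_integrand H i j x)"
      using member_le_sum[of "(i, j)" off_diag "\<lambda>(i, j). chi_integrand H i j x"] by simp
    then show False using assms(2) i j by (simp add: chi_integrand_template top_unique)
  qed
  then show ?thesis using K Kd_nonneg[OF K] by (auto simp: pos_simplex_def order_less_le)
qed

section \<open>Trace and budget as means over templates\<close>

lemma AE_norm_le:
  assumes "AE x in \<rho>. x \<in> Xd H"
  shows "AE x in \<rho>. norm x \<le> sqrt (real CARD('n) * (real CARD('n) - 1))"
  using assms
proof eventually_elim
  case (elim x)
  then have "x \<bullet> x \<le> real CARD('n) * (real CARD('n) - 1)"
    using Sfun_le[of "template H x"] by (simp add: inner_self_eq_Sfun template_in_Kd_iff)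
  then show ?case unfolding norm_eq_sqrt_inner by (rule real_sqrt_le_mono)
qed

lemma trace_Sigma_mat:
  assumes "anchored H \<rho>"
  shows "integrable \<rho> (\<lambda>x. Sfun (template H x))"
    and "trace (Sigma_mat \<rho>) = (\<integral>x. Sfun (template H x) \<partial>\<rho>)"
proof -
  interpret prob_space \<rho> using assms by (simp add: anchored_def)
  have [measurable_cong]: "sets \<rho> = sets borel" using assms by (simp add: anchored_def)
  have X: "AE x in \<rho>. x \<in> Xd H" using assms by (rule anchored_AE_Xd)
  let ?D = "real CARD('n) * (real CARD('n) - 1)"
  have [measurable]: "(\<lambda>x :: real^'m. x $ i) \<in> borel_measurable borel" for i
    by (intro borel_measurable_continuous_onI continuous_intros)
  have int: "integrable \<rho> (\<lambda>x. x $ i * x $ i)" for i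
  proof (rule integrable_const_bound)
    show "AE x in \<rho>. norm (x $ i * x $ i) \<le> sqrt ?D * sqrt ?D"
      using AE_norm_le[OF X]
    proof eventually_elim
      case (elim x)
      then have "\<bar>x $ i\<bar> \<le> sqrt ?D" using component_le_norm_cart order_trans by blast
      then show ?case unfolding real_norm_def abs_mult by (intro mult_mono) auto
    qed
  qed measurable
  have eq: "AE x in \<rho>. (\<Sum>i\<in>UNIV. x $ i * x $ i) = Sfun (template H x)"
    using X by eventually_elim (simp add: inner_self_eq_Sfun[symmetric] inner_vec_def)
  have int_sum: "integrable \<rho> (\<lambda>x. \<Sum>i\<in>UNIV. x $ i * x $ i)"
    using int by (intro Bochner_Integration.integrable_sum)
  show "integrable \<rho> (\<lambda>x. Sfun (template H x))"
    by (rule integrable_cong_AE_imp[OF int_sum]) (use eq in \<open>auto simp: eq_commute\<close>)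
  have "trace (Sigma_mat \<rho>) = (\<integral>x. (\<Sum>i\<in>UNIV. x $ i * x $ i) \<partial>\<rho>)"
    using int by (simp add: trace_def Sigma_mat_def Bochner_Integration.integral_sum)
  also have "\<dots> = (\<integral>x. Sfun (template H x) \<partial>\<rho>)"
    using eq by (intro integral_cong_AE) auto
  finally show "trace (Sigma_mat \<rho>) = (\<integral>x. Sfun (template H x) \<partial>\<rho>)" .
qed

text \<open>Each of the d(d - 1) pair integrals is at most c, and their sum is d(d - 1) times the
  mean of \<open>Cfun\<close>. Finiteness of that sum confines the law almost surely to positive
  templates.\<close>

lemma feasible_budget:
  assumes "anchored H \<rho>" "chi_star H \<rho> \<le> ennreal c" "0 \<le> c"
  shows "AE x in \<rho>. template H x \<in> pos_simplex"
    and "integrable \<rho> (\<lambda>x. Cfun (template H x))"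
    and "(\<integral>x. Cfun (template H x) \<partial>\<rho>) \<le> c"
proof -
  interpret prob_space \<rho> using assms by (simp add: anchored_def)
  have [measurable_cong]: "sets \<rho> = sets borel" using assms by (simp add: anchored_def)
  let ?D = "real CARD('n) * (real CARD('n) - 1)"
  have D: "0 < ?D" using card_ge_2 by simp
  let ?chi = "\<lambda>x. \<Sum>(i, j)\<in>off_diag. chi_integrand H i j x"
  have "(\<integral>\<^sup>+ x. ?chi x \<partial>\<rho>) = (\<Sum>(i, j)\<in>off_diag. \<integral>\<^sup>+ x. chi_integrand H i j x \<partial>\<rho>)"
    by (simp add: case_prod_unfold nn_integral_sum)
  also have "\<dots> \<le> (\<Sum>(i, j)\<in>(off_diag :: ('n \<times> 'n) set). ennreal c)"
    using assms(2) unfolding chi_star_le_iff[OF card_ge_2] by (intro sum_mono) auto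
  also have "\<dots> = ennreal (?D * c)"
    using assms(3) by (simp add: case_prod_unfold ennreal_mult' ennreal_of_nat_eq_real_of_nat card_off_diag)
  finally have chi_le: "(\<integral>\<^sup>+ x. ?chi x \<partial>\<rho>) \<le> ennreal (?D * c)" .
  then have "(\<integral>\<^sup>+ x. ?chi x \<partial>\<rho>) \<noteq> \<infinity>" by (auto simp: top_unique)
  then have "AE x in \<rho>. ?chi x \<noteq> \<infinity>"
    by (intro nn_integral_noteq_infinite) (auto simp: case_prod_unfold)
  with anchored_AE_Xd[OF assms(1)] show pos: "AE x in \<rho>. template H x \<in> pos_simplex"
    by eventually_elim (rule pos_simplexI_chi)
  have nonneg: "AE x in \<rho>. 0 \<le> ?D * Cfun (template H x)"
    using pos by eventually_elim (use D Cfun_nonneg[OF _ card_ge_2] in \<open>simp add: zero_le_mult_iff\<close>)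
  have "(\<integral>\<^sup>+ x. ennreal (?D * Cfun (template H x)) \<partial>\<rho>) = (\<integral>\<^sup>+ x. ?chi x \<partial>\<rho>)"
    using pos by (intro nn_integral_cong_AE) (auto elim!: eventually_mono simp: sum_chi_integrand)
  with chi_le have le: "(\<integral>\<^sup>+ x. ennreal (?D * Cfun (template H x)) \<partial>\<rho>) \<le> ennreal (?D * c)" by simp
  have int: "integrable \<rho> (\<lambda>x. ?D * Cfun (template H x))"
    using le by (intro integrableI_nonneg nonneg) (auto simp: less_top[symmetric] top_unique)
  then show "integrable \<rho> (\<lambda>x. Cfun (template H x))" using card_ge_2 by simp
  have "(\<integral>x. ?D * Cfun (template H x) \<partial>\<rho>) \<le> ?D * c"
    using le D assms(3) nonneg by (subst integral_eq_nn_integral) (auto intro!: enn2real_leI)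
  then show "(\<integral>x. Cfun (template H x) \<partial>\<rho>) \<le> c"
    by (simp only: integral_mult_right_zero mult_le_cancel_left_pos[OF D])
qed

text \<open>Integrates the line inequality. Keeping the budget slack on the right serves both the
  upper bound on the trace and the saturation claim.\<close>

lemma trace_le_supporting_line:
  assumes "anchored H \<rho>" "chi_star H \<rho> \<le> ennreal c" "0 \<le> c"
    and "\<And>a :: real^'n. a \<in> pos_simplex \<Longrightarrow> Sfun a \<le> f + l * (Cfun a - c)"
  shows "trace (Sigma_mat \<rho>) \<le> f + l * ((\<integral>x. Cfun (template H x) \<partial>\<rho>) - c)"
proof -
  interpret prob_space \<rho> using assms by (simp add: anchored_def)
  note C = feasible_budget[OF assms(1-3)]
  have "trace (Sigma_mat \<rho>) \<le> (\<integral>x. f + l * (Cfun (template H x) - c) \<partial>\<rho>)"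
    unfolding trace_Sigma_mat(2)[OF assms(1)]
  proof (rule integral_mono_AE[OF trace_Sigma_mat(1)[OF assms(1)]])
    show "integrable \<rho> (\<lambda>x. f + l * (Cfun (template H x) - c))" using C(2) by simp
    show "AE x in \<rho>. Sfun (template H x) \<le> f + l * (Cfun (template H x) - c)"
      using C(1) by eventually_elim (rule assms(4))
  qed
  also have "\<dots> = f + l * ((\<integral>x. Cfun (template H x) \<partial>\<rho>) - c)"
    using C(2) by (simp add: prob_space)
  finally show ?thesis .
qed

end

section \<open>Orbit mixtures\<close>

lemma nn_integral_borel_law:
  "g \<in> borel_measurable borel \<Longrightarrow> (\<integral>\<^sup>+ x. g x \<partial>borel_law q) = (\<integral>\<^sup>+ x. g x \<partial>measure_pmf q)"
  unfolding borel_law_def by (subst nn_integral_distr) auto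

lemma distr_borel_law:
  fixes T :: "real^'m \<Rightarrow> real^'m"
  assumes "T \<in> borel_measurable borel"
  shows "distr (borel_law q) borel T = borel_law (map_pmf T q)"
proof -
  have "distr (borel_law q) borel T = distr (measure_pmf q) borel T"
    unfolding borel_law_def using assms by (subst distr_distr) (auto simp: o_def)
  also have "\<dots> = borel_law (map_pmf T q)"
    unfolding borel_law_def map_pmf_rep_eq by (subst distr_distr) (auto simp: o_def)
  finally show ?thesis .
qed

lemma nn_integral_orbit_pmf:
  fixes H :: "real^'m^'n"
  assumes "\<And>p. p permutes UNIV \<Longrightarrow> g (Pmat H p *v xa H a) = u"
  shows "(\<integral>\<^sup>+ x. g x \<partial>measure_pmf (orbit_pmf H a)) = u"
proof -
  let ?P = "{p. p permutes (UNIV :: 'n set)}"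
  have P: "finite ?P" "?P \<noteq> {}" using permutes_id[of "UNIV :: 'b set"] by (blast intro: finite_permutations finite)+
  have "(\<integral>\<^sup>+ x. g x \<partial>measure_pmf (orbit_pmf H a)) = (\<integral>\<^sup>+ p. u \<partial>measure_pmf (pmf_of_set ?P))"
    unfolding orbit_pmf_def nn_integral_map_pmf
    by (intro nn_integral_cong_AE) (simp add: AE_measure_pmf_iff set_pmf_of_set[OF P(2,1)] assms)
  then show ?thesis by (simp add: measure_pmf.emeasure_space_1[simplified])
qed

text \<open>For integrands constant on each of the two orbits: the indicator of \<open>Xd H\<close>,
  \<open>Sfun\<close> of the template, and the sum of all pair integrands.\<close>

lemma nn_integral_orbit_mixture:
  assumes "g \<in> borel_measurable borel" "t \<in> {0..1}"
    and "\<And>p. p permutes UNIV \<Longrightarrow> g (Pmat H p *v xa H a) = u"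
    and "\<And>p. p permutes UNIV \<Longrightarrow> g (Pmat H p *v xa H b) = v"
  shows "(\<integral>\<^sup>+ x. g x \<partial>orbit_mixture H t a b) = u * ennreal t + v * ennreal (1 - t)"
  using assms(2) unfolding orbit_mixture_def nn_integral_borel_law[OF assms(1)] mixture_pmf_def
  by (simp add: nn_integral_orbit_pmf[of g H a u, OF assms(3)] nn_integral_orbit_pmf[of g H b v, OF assms(4)])

context centred_frame
begin

text \<open>Composing with \<open>p\<close> on the left permutes the permutations, so their uniform
  law is unchanged.\<close>

lemma map_pmf_orbit_pmf:
  assumes "p permutes UNIV"
  shows "map_pmf (\<lambda>x. Pmat H p *v x) (orbit_pmf H a) = orbit_pmf H a"
proof -
  let ?P = "{p. p permutes (UNIV :: 'n set)}"
  have P: "finite ?P" "?P \<noteq> {}" using permutes_id[of "UNIV :: 'n set"] by (blast intro: finite_permutations finite)+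
  have "bij_betw ((\<circ>) p) ?P ?P"
    unfolding bij_betw_def
  proof
    have "(\<circ>) p ` ?P = {p \<circ> q | q. q permutes UNIV}" by auto
    then show "(\<circ>) p ` ?P = ?P" using image_compose_permutations_left[OF assms] by simp
    show "inj_on ((\<circ>) p) ?P"
      using permutes_inj[OF assms] by (auto simp: inj_on_def inj_def fun_eq_iff)
  qed
  then have "map_pmf ((\<circ>) p) (pmf_of_set ?P) = pmf_of_set ?P"
    using P by (intro map_pmf_of_set_bij_betw)
  moreover have "map_pmf (\<lambda>x. Pmat H p *v x) (orbit_pmf H a)
      = map_pmf (\<lambda>q. Pmat H q *v xa H a) (map_pmf ((\<circ>) p) (pmf_of_set ?P))"
    unfolding orbit_pmf_def map_pmf_comp
    by (rule map_pmf_cong) (simp_all add: set_pmf_of_set[OF P(2,1)] Pmat_comp[OF assms])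
  ultimately show ?thesis by (simp add: orbit_pmf_def)
qed

lemma exchangeable_orbit_mixture: "exchangeable H (orbit_mixture H t a b)"
proof -
  have "map_pmf (\<lambda>x. Pmat H p *v x) (mixture_pmf t (orbit_pmf H a) (orbit_pmf H b))
      = mixture_pmf t (orbit_pmf H a) (orbit_pmf H b)" if "p permutes UNIV" for p
    unfolding mixture_pmf_def map_bind_pmf
    by (simp add: if_distrib map_pmf_orbit_pmf[OF that] cong: if_cong)
  then show ?thesis
    unfolding exchangeable_def orbit_mixture_def by (simp add: distr_borel_law)
qed

text \<open>The mean is fixed by every \<open>Pmat H p\<close>, so transpositions force its template
  to be constant; as \<open>H *v v\<close> sums to zero, it vanishes.\<close>

lemma exchangeable_integral_eq_0:
  assumes "exchangeable H \<rho>" "sets \<rho> = sets borel" "integrable \<rho> (\<lambda>x. x)"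
  shows "(\<integral>x. x \<partial>\<rho>) = 0"
proof -
  define v where "v = (\<integral>x. x \<partial>\<rho>)"
  have [measurable_cong]: "sets \<rho> = sets borel" by fact
  have fixed: "Pmat H p *v v = v" if "p permutes UNIV" for p
  proof -
    have "v = (\<integral>x. x \<partial>distr \<rho> borel (\<lambda>x. Pmat H p *v x))"
      using assms(1) that by (simp add: exchangeable_def v_def)
    also have "\<dots> = (\<integral>x. Pmat H p *v x \<partial>\<rho>)" by (rule integral_distr) auto
    also have "\<dots> = Pmat H p *v v"
      unfolding v_def by (rule integral_bounded_linear[OF matrix_vector_mul_bounded_linear assms(3)])
    finally show ?thesis ..
  qed
  have "template H v $ i = template H v $ j" for i j
  proof -
    let ?p = "Transposition.transpose i j"
    have p: "?p permutes UNIV" by (rule permutes_swap_id) auto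
    have "template H v = perm_vec (inv ?p) (template H v)" using template_Pmat[OF p, of v] fixed[OF p] by simp
    then have "template H v $ i = template H v $ inv ?p i" by (metis perm_vec_def vec_lambda_beta)
    then show ?thesis by simp
  qed
  then have const: "(H *v v) $ i = (H *v v) $ j" for i j by (simp add: template_def)
  have "(H *v v) $ i = 0" for i
  proof -
    have "0 = (\<Sum>j\<in>UNIV. (H *v v) $ j)" by (simp only: sum_mult)
    also have "\<dots> = (\<Sum>j\<in>(UNIV :: 'n set). (H *v v) $ i)" using const by (intro sum.cong) auto
    also have "\<dots> = real CARD('n) * (H *v v) $ i" by simp
    finally show ?thesis using card_ge_2 by simp
  qed
  then have "H *v v = 0" by (simp add: vec_eq_iff)
  then show ?thesis using transpose_mult_mult[of v] by (simp add: v_def)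
qed

text \<open>Some permutation carries one ordered pair to the other, and the law is invariant under
  it.\<close>

lemma exchangeable_chi_integral_eq:
  assumes "exchangeable H \<rho>" "sets \<rho> = sets borel" "i \<noteq> j" "k \<noteq> l"
  shows "(\<integral>\<^sup>+ x. chi_integrand H i j x \<partial>\<rho>) = (\<integral>\<^sup>+ x. chi_integrand H k l x \<partial>\<rho>)"
proof -
  have [measurable_cong]: "sets \<rho> = sets borel" by fact
  obtain p where p: "p permutes UNIV" "p k = i" "p l = j"
    using ex_perm_two_points[OF assms(4,3)] by blast
  have "(\<integral>\<^sup>+ x. chi_integrand H i j x \<partial>\<rho>) = (\<integral>\<^sup>+ x. chi_integrand H i j x \<partial>distr \<rho> borel (\<lambda>x. Pmat H p *v x))"
    using assms(1) p(1) by (simp add: exchangeable_def)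
  also have "\<dots> = (\<integral>\<^sup>+ x. chi_integrand H i j (Pmat H p *v x) \<partial>\<rho>)" by (rule nn_integral_distr) auto
  also have "\<dots> = (\<integral>\<^sup>+ x. chi_integrand H k l x \<partial>\<rho>)"
    unfolding chi_integrand_Pmat[OF p(1)] p(2,3)[symmetric] permutes_inverses(2)[OF p(1)] ..
  finally show ?thesis .
qed

lemma template_orbit:
  assumes "a \<in> pos_simplex" "p permutes UNIV"
  shows "template H (Pmat H p *v xa H a) = perm_vec (inv p) a"
    and "template H (Pmat H p *v xa H a) \<in> pos_simplex"
  using assms by (simp_all add: template_Pmat template_xa pos_simplex_Kd perm_vec_pos_simplex permutes_inv)

lemma orbit_mixture_feasible:
  assumes "a \<in> pos_simplex" "b \<in> pos_simplex" "t \<in> {0..1}"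
  shows "anchored H (orbit_mixture H t a b)"
    and "chi_star H (orbit_mixture H t a b) \<le> ennreal (t * Cfun a + (1 - t) * Cfun b)"
    and "trace (Sigma_mat (orbit_mixture H t a b)) = t * Sfun a + (1 - t) * Sfun b"
proof -
  let ?m = "orbit_mixture H t a b"
  have sets: "sets ?m = sets borel" by (simp add: orbit_mixture_def borel_law_def)
  note [measurable_cong] = sets
  have prob: "prob_space ?m"
    unfolding orbit_mixture_def borel_law_def by (rule measure_pmf.prob_space_distr) simp
  interpret prob_space ?m by (rule prob)
  note nn = nn_integral_orbit_mixture[OF _ assms(3), where H = H and a = a and b = b]
  note tpl = template_orbit[OF assms(1)] template_orbit[OF assms(2)]
  note perm = Cfun_perm_vec[OF permutes_inv] Sfun_perm_vec[OF permutes_inv]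
  have orbit_Xd: "Pmat H p *v xa H a \<in> Xd H" "Pmat H p *v xa H b \<in> Xd H" if "p permutes UNIV" for p
    using tpl(2,4)[OF that] pos_simplex_Kd template_in_Kd_iff by blast+
  have t: "ennreal t + ennreal (1 - t) = 1" using assms(3) by (simp flip: ennreal_plus)
  have "emeasure ?m (Xd H) = (\<integral>\<^sup>+ x. indicator (Xd H) x \<partial>?m)" by simp
  also have "\<dots> = 1 * ennreal t + 1 * ennreal (1 - t)"
    by (rule nn) (simp_all add: orbit_Xd)
  finally have Xd: "emeasure ?m (Xd H) = 1" using t by simp
  then have "prob (Xd H) = 1" by (simp add: measure_def)
  then have AE_Xd: "AE x in ?m. x \<in> Xd H" using prob_eq_1[of "Xd H"] sets by simp
  have int: "integrable ?m (\<lambda>x. x)"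
    using AE_norm_le[OF AE_Xd] by (rule integrable_const_bound) measurable
  show anchored: "anchored H ?m"
    unfolding anchored_def
    using prob sets Xd int exchangeable_integral_eq_0[OF exchangeable_orbit_mixture sets int] by blast
  have "AE x in ?m. 0 \<le> Sfun (template H x)"
    using AE_Xd by eventually_elim (simp add: Sfun_nonneg template_in_Kd_iff)
  then have "trace (Sigma_mat ?m) = enn2real (\<integral>\<^sup>+ x. ennreal (Sfun (template H x)) \<partial>?m)"
    unfolding trace_Sigma_mat(2)[OF anchored] by (intro integral_eq_nn_integral) auto
  also have "(\<integral>\<^sup>+ x. ennreal (Sfun (template H x)) \<partial>?m)
      = ennreal (Sfun a) * ennreal t + ennreal (Sfun b) * ennreal (1 - t)"
    by (rule nn) (simp_all add: tpl perm)
  also have "\<dots> = ennreal (t * Sfun a + (1 - t) * Sfun b)"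
    using assms(3) Sfun_nonneg[OF pos_simplex_Kd[OF assms(1)]] Sfun_nonneg[OF pos_simplex_Kd[OF assms(2)]]
    by (simp add: mult.commute flip: ennreal_mult ennreal_plus)
  also have "enn2real \<dots> = t * Sfun a + (1 - t) * Sfun b"
    using assms(3) Sfun_nonneg[OF pos_simplex_Kd[OF assms(1)]] Sfun_nonneg[OF pos_simplex_Kd[OF assms(2)]]
    by (intro enn2real_ennreal) auto
  finally show "trace (Sigma_mat ?m) = t * Sfun a + (1 - t) * Sfun b" .
  define D where "D = real CARD('n) * (real CARD('n) - 1)"
  have D: "0 < D" using card_ge_2 by (simp add: D_def)
  let ?c = "t * Cfun a + (1 - t) * Cfun b"
  have C: "0 \<le> Cfun a" "0 \<le> Cfun b" using Cfun_nonneg card_ge_2 assms(1,2) by auto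
  have "(\<integral>\<^sup>+ x. chi_integrand H i j x \<partial>?m) \<le> ennreal ?c" if "(i, j) \<in> off_diag" for i j
  proof -
    define I where "I = (\<integral>\<^sup>+ x. chi_integrand H i j x \<partial>?m)"
    \<comment> \<open>A single integrand need not be constant on an orbit, but the sum over all
      pairs is. By exchangeability each pair integral is the \<open>D\<close>-th part of the
      total.\<close>
    have "ennreal D * I = (\<Sum>(k, l)\<in>(off_diag :: ('n \<times> 'n) set). I)"
      by (simp add: case_prod_unfold D_def ennreal_of_nat_eq_real_of_nat card_off_diag)
    also have "\<dots> = (\<Sum>(k, l)\<in>off_diag. \<integral>\<^sup>+ x. chi_integrand H k l x \<partial>?m)"
    proof (rule sum.cong, goal_cases)
      case (2 z)
      then show ?case
        using that exchangeable_chi_integral_eq[OF exchangeable_orbit_mixture sets, of i j "fst z" "snd z"]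
        by (simp add: case_prod_unfold off_diag_def I_def)
    qed simp
    also have "\<dots> = (\<integral>\<^sup>+ x. (\<Sum>(k, l)\<in>off_diag. chi_integrand H k l x) \<partial>?m)"
      by (simp add: case_prod_unfold nn_integral_sum)
    also have "\<dots> = ennreal (D * Cfun a) * ennreal t + ennreal (D * Cfun b) * ennreal (1 - t)"
    proof (rule nn)
      show "(\<lambda>x. \<Sum>(k, l)\<in>off_diag. chi_integrand H k l x) \<in> borel_measurable borel"
        by (simp add: case_prod_unfold)
      fix p :: "'n \<Rightarrow> 'n" assume p: "p permutes UNIV"
      show "(\<Sum>(k, l)\<in>off_diag. chi_integrand H k l (Pmat H p *v xa H a)) = ennreal (D * Cfun a)"
        by (simp only: sum_chi_integrand[OF tpl(2)[OF p]] tpl(1)[OF p] perm(1)[OF p] D_def)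
      show "(\<Sum>(k, l)\<in>off_diag. chi_integrand H k l (Pmat H p *v xa H b)) = ennreal (D * Cfun b)"
        by (simp only: sum_chi_integrand[OF tpl(4)[OF p]] tpl(3)[OF p] perm(1)[OF p] D_def)
    qed
    also have "\<dots> = ennreal (D * Cfun a * t + D * Cfun b * (1 - t))"
      using assms(3) C D by (simp flip: ennreal_mult ennreal_plus)
    also have "D * Cfun a * t + D * Cfun b * (1 - t) = D * ?c" by (simp add: algebra_simps)
    also have "ennreal (D * ?c) = ennreal D * ennreal ?c"
      using assms(3) C D by (intro ennreal_mult) auto
    finally have "I = ennreal ?c" using D by (simp add: ennreal_mult_cancel_left)
    then show ?thesis by (simp add: I_def)
  qed
  then show "chi_star H ?m \<le> ennreal ?c" unfolding chi_star_le_iff[OF card_ge_2] by blast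
qed

end

section \<open>Assembly: value, attainment and saturation\<close>

theorem theorem7p9:
  fixes H :: "real^'m^'n::{finite,linorder}" and C0 :: real
  assumes "2 \<le> CARD('n)"
    and "CARD('m) + 1 = CARD('n)"
    and "transpose H ** H = mat 1"
    and "range (\<lambda>x. H *v x) = {u. (\<Sum>i\<in>UNIV. u $ i) = 0}"
    and "0 \<le> C0"
  shows "Fd H C0 = Sup {s. \<exists>c. (c, s) \<in> convex hull (Gamma_d TYPE('n)) \<and> c \<le> C0}
    \<and> (\<exists>a\<in>Omega_d. \<exists>b\<in>Omega_d. \<exists>t\<in>{0..1}.
          Fd H C0 = t * Sfun a + (1 - t) * Sfun b
        \<and> t * Cfun a + (1 - t) * Cfun b = C0
        \<and> anchored H (orbit_mixture H t a b)
        \<and> exchangeable H (orbit_mixture H t a b)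
        \<and> chi_star H (orbit_mixture H t a b) \<le> ennreal C0
        \<and> trace (Sigma_mat (orbit_mixture H t a b)) = Fd H C0)
    \<and> (0 < C0 \<longrightarrow> (\<forall>\<rho>. anchored H \<rho> \<and> exchangeable H \<rho> \<and> chi_star H \<rho> \<le> ennreal C0
          \<and> trace (Sigma_mat \<rho>) = Fd H C0
          \<longrightarrow> (\<integral>a. Cfun a \<partial>(sorted_template_law H \<rho>)) = C0))"
proof -
  interpret centred_frame H using assms(1,3,4) by unfold_locales
  obtain f l t and a b :: "real^'n::{finite,linorder}" where
    l: "0 < l" and line: "\<And>x :: real^'n::{finite,linorder}. x \<in> pos_simplex \<Longrightarrow> Sfun x \<le> f + l * (Cfun x - C0)"
    and ab: "a \<in> Omega_d" "b \<in> Omega_d" "t \<in> {0..1}"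
    and C: "t * Cfun a + (1 - t) * Cfun b = C0" and S: "t * Sfun a + (1 - t) * Sfun b = f"
    using optimal_pair[OF assms(1,5)] by metis
  let ?m = "orbit_mixture H t a b"
  have pos: "a \<in> pos_simplex" "b \<in> pos_simplex" using ab by (simp_all add: Omega_d_eq)
  note m = orbit_mixture_feasible[OF pos ab(3), unfolded C S]
  have Fd: "Fd H C0 = f"
    unfolding Fd_def
  proof (rule cSup_eq_maximum)
    show "f \<in> {trace (Sigma_mat \<rho>) |\<rho>. anchored H \<rho> \<and> chi_star H \<rho> \<le> ennreal C0}"
      using m by blast
    fix s assume "s \<in> {trace (Sigma_mat \<rho>) |\<rho>. anchored H \<rho> \<and> chi_star H \<rho> \<le> ennreal C0}"
    then obtain \<rho> where \<rho>: "s = trace (Sigma_mat \<rho>)" "anchored H \<rho>" "chi_star H \<rho> \<le> ennreal C0" by blast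
    have "l * ((\<integral>x. Cfun (template H x) \<partial>\<rho>) - C0) \<le> 0"
      using l feasible_budget(3)[OF \<rho>(2,3) assms(5)] by (simp add: mult_le_0_iff)
    then show "s \<le> f" using trace_le_supporting_line[OF \<rho>(2,3) assms(5) line] \<rho>(1) by linarith
  qed
  have saturated: "(\<integral>a. Cfun a \<partial>(sorted_template_law H \<rho>)) = C0"
    if "anchored H \<rho>" "chi_star H \<rho> \<le> ennreal C0" "trace (Sigma_mat \<rho>) = Fd H C0" for \<rho>
  proof -
    have [measurable_cong]: "sets \<rho> = sets borel" using that(1) by (simp add: anchored_def)
    have [measurable]: "(sort_desc :: real^'n::{finite,linorder} \<Rightarrow> _) \<in> borel_measurable borel"
      by (intro borel_measurable_continuous_onI continuous_on_sort_desc)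
    have "(\<integral>a. Cfun a \<partial>(sorted_template_law H \<rho>)) = (\<integral>x. Cfun (sort_desc (template H x)) \<partial>\<rho>)"
      unfolding sorted_template_law_def by (rule integral_distr) auto
    also have "\<dots> = (\<integral>x. Cfun (template H x) \<partial>\<rho>)" by (simp add: Cfun_sort_desc)
    also have "\<dots> = C0"
    proof (rule antisym)
      show "(\<integral>x. Cfun (template H x) \<partial>\<rho>) \<le> C0" using feasible_budget(3)[OF that(1,2) assms(5)] .
      have "0 \<le> l * ((\<integral>x. Cfun (template H x) \<partial>\<rho>) - C0)"
        using trace_le_supporting_line[OF that(1,2) assms(5) line] that(3) Fd by linarith
      then show "C0 \<le> (\<integral>x. Cfun (template H x) \<partial>\<rho>)" using l by (simp add: zero_le_mult_iff)
    qed
    finally show ?thesis .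
  qed
  have "Fd H C0 = Sup {s. \<exists>c. (c, s) \<in> convex hull (Gamma_d TYPE('n)) \<and> c \<le> C0}"
    unfolding Fd by (rule Sup_hull_Gamma_d[OF l line ab C S, symmetric])
  moreover have "Fd H C0 = t * Sfun a + (1 - t) * Sfun b" "trace (Sigma_mat ?m) = Fd H C0"
    using Fd S m(3) by simp_all
  ultimately show ?thesis
    using ab C m(1,2) exchangeable_orbit_mixture saturated by blast
qed

end
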